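(* Let $X\in\mathbb{P}_m$, $\mu\in\mathcal{P}^1(\mathbb{P}_m)$ and $\beta(t)=G(X\#_t\mu)$ for $t\in\mathbb{R}$ (which is differentiable at $t=0$). Then the following are equivalent: (i) $\beta'(0)=0$; (ii) $X=G(\mu)$; (iii) $X=G(X\#_t\mu)$ for all $t\in\mathbb{R}$ (equivalently, for some $t\neq0$); (iv) $I=G(\mu_X^t)$ for all $t\in\mathbb{R}$ (equivalently, for some $t\neq0$).
   Context: $\mathbb{P}_m$ denotes the set of $m\times m$ complex positive definite matrices, with the Riemannian distance $d(A,B)=\|\log(A^{-1/2}BA^{-1/2})\|_2$, where $\|Z\|_2=(\mathrm{tr}\,Z^2)^{1/2}$. For $A,B\in\mathbb{P}_m$ and $t\in\mathbb{R}$, $A\#_tB:=A^{1/2}(A^{-1/2}BA^{-1/2})^tA^{1/2}$. $\mathcal{P}^1(\mathbb{P}_m)$ is the set of Borel probability measures $\mu$ on $\mathbb{P}_m$ with $\int_{\mathbb{P}_m}d(Z,W)\,d\mu(Z)<\infty$ for some (equivalently all) $W$. The Cartan barycenter of $\mu\in\mathcal{P}^1(\mathbb{P}_m)$ is $G(\mu)=\mathrm{arg\,min}_{Z\in\mathbb{P}_m}\int_{\mathbb{P}_m}[d^2(Z,A)-d^2(W,A)]\,d\mu(A)$ (unique, independent of the fixed $W$). $X\#_t\mu$ is the push-forward of $\mu$ under $A\mapsto X\#_tA$. $\mu_X$ is the push-forward of $\mu$ under $A\mapsto X^{-1/2}AX^{-1/2}$, and $\mu_X^t$ is the push-forward of $\mu_X$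 under $A\mapsto A^t$. $I$ is the $m\times m$ identity matrix. *)

theory Defs
  imports "HOL-Probability.Probability"
begin

definition cadj :: "complex^'m^'m \<Rightarrow> complex^'m^'m" where
  "cadj A = (\<chi> i j. cnj (A $ j $ i))"

definition hermitian :: "complex^'m^'m \<Rightarrow> bool" where
  "hermitian A \<longleftrightarrow> cadj A = A"

definition posdef :: "complex^'m^'m \<Rightarrow> bool" where
  "posdef A \<longleftrightarrow> hermitian A \<and>
     (\<forall>x::complex^'m. x \<noteq> 0 \<longrightarrow> Re (\<Sum>i\<in>UNIV. \<Sum>j\<in>UNIV. cnj (x $ i) * A $ i $ j * x $ j) > 0)"

definition PD :: "(complex^'m^'m) set" where
  "PD = {A. posdef A}"

definition unitary :: "complex^'m^'m \<Rightarrow> bool" where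
  "unitary U \<longleftrightarrow> cadj U ** U = mat 1"

definition diagm :: "('m \<Rightarrow> real) \<Rightarrow> complex^'m^'m" where
  "diagm l = (\<chi> i j. if i = j then complex_of_real (l i) else 0)"

text \<open>Functional calculus on positive definite matrices via unitary diagonalisation
  (independent of the chosen diagonalisation); junk value 0 outside PD.\<close>
definition mfun :: "(real \<Rightarrow> real) \<Rightarrow> complex^'m^'m \<Rightarrow> complex^'m^'m" where
  "mfun f A = (if posdef A then
     (SOME B. \<exists>U l. unitary U \<and> (\<forall>i. l i > 0) \<and> A = U ** diagm l ** cadj U \<and>
                    B = U ** diagm (\<lambda>i. f (l i)) ** cadj U)
   else 0)"

definition mpow :: "complex^'m^'m \<Rightarrow> real \<Rightarrow> complex^'m^'m" where
  "mpow A t = mfun (\<lambda>x. x powr t) A"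

definition mlog :: "complex^'m^'m \<Rightarrow> complex^'m^'m" where
  "mlog A = mfun ln A"

definition wgeo :: "complex^'m^'m \<Rightarrow> real \<Rightarrow> complex^'m^'m \<Rightarrow> complex^'m^'m" where
  "wgeo A t B = mpow A (1/2) ** mpow (mpow A (-1/2) ** B ** mpow A (-1/2)) t ** mpow A (1/2)"

definition rdist :: "complex^'m^'m \<Rightarrow> complex^'m^'m \<Rightarrow> real" where
  "rdist A B = (let L = mlog (mpow A (-1/2) ** B ** mpow A (-1/2)) in sqrt (Re (trace (L ** L))))"

definition P1 :: "(complex^'m^'m) measure \<Rightarrow> bool" where
  "P1 M \<longleftrightarrow> sets M = sets borel \<and> prob_space M \<and> emeasure M PD = 1 \<and>
     (\<exists>W\<in>PD. (\<integral>\<^sup>+ Z. ennreal (rdist Z W) \<partial>M) < \<infinity>)"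

definition cartan_obj :: "(complex^'m^'m) measure \<Rightarrow> complex^'m^'m \<Rightarrow> complex^'m^'m \<Rightarrow> real" where
  "cartan_obj M W Z = (\<integral>A. (rdist Z A)\<^sup>2 - (rdist W A)\<^sup>2 \<partial>M)"

definition barycenter :: "(complex^'m^'m) measure \<Rightarrow> complex^'m^'m" where
  "barycenter M = (THE Z. Z \<in> PD \<and> (\<forall>Y\<in>PD. cartan_obj M (mat 1) Z \<le> cartan_obj M (mat 1) Y))"

definition push_geo :: "complex^'m^'m \<Rightarrow> real \<Rightarrow> (complex^'m^'m) measure \<Rightarrow> (complex^'m^'m) measure" where
  "push_geo X t M = distr M borel (\<lambda>A. wgeo X t A)"

definition congr_meas :: "complex^'m^'m \<Rightarrow> (complex^'m^'m) measure \<Rightarrow> (complex^'m^'m) measure" where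
  "congr_meas X M = distr M borel (\<lambda>A. mpow X (-1/2) ** A ** mpow X (-1/2))"

definition pow_meas :: "real \<Rightarrow> (complex^'m^'m) measure \<Rightarrow> (complex^'m^'m) measure" where
  "pow_meas t N = distr N borel (\<lambda>A. mpow A t)"

end

(* A critical point of the objective is characterised by the vanishing of h(X), the integral of
   log(X^(-1/2) A X^(-1/2)); replacing mu by X #_t mu multiplies h(X) by t, which gives
   (ii) <-> (iii) <-> (iv).  If beta'(0) = 0, then (1/t) h(beta(t)), computed for X #_t mu,
   is identically zero and tends to h(X) by dominated convergence, whence (i) -> (ii).

   All the geometry rests on |log P - log Q| <= d(P, Q) for the Frobenius norm.  In eigenbases of
   P and Q the inequality (ln x)^2 <= x + 1/x - 2 gives
   |log P - log Q|^2 <= tr(P^-1 Q) + tr(Q^-1 P) - 2m, and subdividing the geodesic from P to Q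
   replaces the right-hand side by d(P, Q)^2 in the limit.  Congruence invariance turns this into
   the CAT(0) law of cosines at every base point, from which follow the triangle inequality, the
   uniqueness of minimisers and the first variation formula. *)

theory Submission
  imports Defs "HOL-Real_Asymp.Real_Asymp"
begin

text \<open>The bound tr(P^-1 Q) + tr(Q^-1 P) - 2m is chosen because it is the sum of r + 1/r - 2
  over the eigenvalues r of P^(-1/2) Q P^(-1/2), whereas d(P, Q)^2 is the sum of (ln r)^2: the two
  agree to leading order at r = 1. Yet it involves only traces of products, so in eigenbases it
  carries the same weights as |log P - log Q|^2 and the comparison is scalar. This takes the place
  of differentiating the matrix exponential. Only a first moment is available, so d^2 itself may
  fail to be integrable; differences of squares have linear growth and are integrable. In (i) ->
  (ii) the curve \<beta> is known only implicitly. Instead of differentiating h(\<beta>(t)) = 0, the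
  hypothesis is read as \<beta>(t) = X + o(t). Then the moving base point drops out of the limit,
  and d(\<beta>(t), X) / t stays bounded along a sequence t -> 0, which supplies the dominating
  function.\<close>

section \<open>Matrix algebra, unitary matrices and the Frobenius norm\<close>

lemma cadj_nth [simp]: "cadj A $ i $ j = cnj (A $ j $ i)"
  by (simp add: cadj_def)

lemma cadj_cadj [simp]: "cadj (cadj A) = A"
  by (simp add: vec_eq_iff)

lemma cadj_mult: "cadj (A ** B) = cadj B ** cadj A"
  by (simp add: vec_eq_iff matrix_matrix_mult_def mult.commute)

lemma cadj_mat_1 [simp]: "cadj (mat 1) = mat 1"
  by (auto simp: vec_eq_iff mat_def)

lemma cadj_diagm [simp]: "cadj (diagm l) = diagm l"
  by (simp add: vec_eq_iff diagm_def)

lemma diagm_mult_nth: "(diagm l ** A) $ i $ j = of_real (l i) * A $ i $ j"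
proof -
  have "(diagm l ** A) $ i $ j = (\<Sum>k\<in>UNIV. if i = k then of_real (l i) * A $ k $ j else 0)"
    by (simp add: matrix_matrix_mult_def diagm_def if_distrib[of "\<lambda>x. x * _"] cong: if_cong)
  then show ?thesis by simp
qed

lemma mult_diagm_nth: "(A ** diagm l) $ i $ j = A $ i $ j * of_real (l j)"
proof -
  have "(A ** diagm l) $ i $ j = (\<Sum>k\<in>UNIV. if k = j then A $ i $ k * of_real (l k) else 0)"
    by (simp add: matrix_matrix_mult_def diagm_def if_distrib[of "\<lambda>x. _ * x"] cong: if_cong)
  then show ?thesis by simp
qed

lemma diagm_mult_diagm: "diagm a ** diagm b = diagm (\<lambda>i. a i * b i)"
  by (auto simp: vec_eq_iff diagm_mult_nth) (auto simp: diagm_def)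

lemma diagm_1 [simp]: "diagm (\<lambda>i. 1) = mat 1"
  by (simp add: vec_eq_iff diagm_def mat_def)

lemma bounded_linear_cadj: "bounded_linear (cadj :: complex^'m^'m \<Rightarrow> complex^'m^'m)"
  by (rule linear_conv_bounded_linear[THEN iffD1], rule linearI) (auto simp: vec_eq_iff)

lemma bounded_bilinear_matrix_mult:
  "bounded_bilinear ((**) :: complex^'m^'m \<Rightarrow> complex^'m^'m \<Rightarrow> complex^'m^'m)"
proof (rule bilinear_conv_bounded_bilinear[THEN iffD1], unfold bilinear_def, intro conjI allI)
  show "linear ((**) A)" for A :: "complex^'m^'m"
    by (rule linearI)
      (auto simp: vec_eq_iff matrix_matrix_mult_def algebra_simps sum.distrib scaleR_sum_right)
  show "linear (\<lambda>A. A ** B)" for B :: "complex^'m^'m"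
    by (rule linearI)
      (auto simp: vec_eq_iff matrix_matrix_mult_def algebra_simps sum.distrib scaleR_sum_right)
qed

lemmas matrix_mult_scaleR_left = bounded_bilinear.scaleR_left[OF bounded_bilinear_matrix_mult]
lemmas matrix_mult_scaleR_right = bounded_bilinear.scaleR_right[OF bounded_bilinear_matrix_mult]
lemmas matrix_mult_diff_left = bounded_bilinear.diff_left[OF bounded_bilinear_matrix_mult]
lemmas matrix_mult_diff_right = bounded_bilinear.diff_right[OF bounded_bilinear_matrix_mult]
lemmas tendsto_matrix_mult [tendsto_intros] =
  bounded_bilinear.tendsto[OF bounded_bilinear_matrix_mult]
lemmas continuous_on_matrix_mult_complex [continuous_intros] =
  bounded_bilinear.continuous_on[OF bounded_bilinear_matrix_mult]

lemma matrix_mult_zero [simp]: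
  "(0 :: complex^'m^'m) ** A = 0" "A ** (0 :: complex^'m^'m) = 0"
  by (simp_all add: vec_eq_iff matrix_matrix_mult_def)

text \<open>The Euclidean structure of the nested vector type is thus the real Hilbert-Schmidt one,
  and \<open>norm\<close> is the Frobenius norm.\<close>

lemma inner_matrix: "inner A B = Re (trace (A ** cadj B))" for A B :: "complex^'m^'m"
  by (simp add: inner_vec_def trace_def matrix_matrix_mult_def inner_complex_def)

lemma norm_matrix_power2: "(norm A)\<^sup>2 = (\<Sum>i\<in>UNIV. \<Sum>j\<in>UNIV. (cmod (A $ i $ j))\<^sup>2)"
  for A :: "complex^'m^'m"
  by (simp add: power2_norm_eq_inner inner_vec_def inner_complex_def cmod_power2)

lemma norm_matrix_eq_trace: "(norm A)\<^sup>2 = Re (trace (A ** cadj A))" for A :: "complex^'m^'m"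
  by (simp add: power2_norm_eq_inner inner_matrix)

lemma unitary_right: "unitary U \<Longrightarrow> U ** cadj U = mat 1"
  by (simp add: unitary_def matrix_left_right_inverse)

lemma unitary_left: "unitary U \<Longrightarrow> cadj U ** U = mat 1"
  by (simp add: unitary_def)

lemma unitary_cadj: "unitary U \<Longrightarrow> unitary (cadj U)"
  by (simp add: unitary_def unitary_right)

lemma unitary_mult: "unitary U \<Longrightarrow> unitary V \<Longrightarrow> unitary (U ** V)"
proof -
  assume U: "unitary U" and V: "unitary V"
  have "cadj (U ** V) ** (U ** V) = cadj V ** (cadj U ** U) ** V"
    by (simp add: cadj_mult matrix_mul_assoc)
  then show ?thesis using U V by (simp add: unitary_def)
qed

lemma norm_mult_unitary: "norm (A ** U) = norm A" if "unitary U" for A :: "complex^'m^'m"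
proof -
  have "(A ** U) ** cadj (A ** U) = A ** (U ** cadj U) ** cadj A"
    by (simp add: cadj_mult matrix_mul_assoc)
  then have "(norm (A ** U))\<^sup>2 = (norm A)\<^sup>2"
    by (simp add: norm_matrix_eq_trace unitary_right[OF that])
  then show ?thesis by simp
qed

lemma norm_unitary_mult: "norm (U ** A) = norm A" if "unitary U" for A :: "complex^'m^'m"
proof -
  have "trace ((U ** A) ** cadj (U ** A)) = trace (cadj (U ** A) ** (U ** A))"
    by (rule trace_mul_sym)
  also have "cadj (U ** A) ** (U ** A) = cadj A ** (cadj U ** U) ** A"
    by (simp add: cadj_mult matrix_mul_assoc)
  also have "\<dots> = cadj A ** A"
    by (simp add: unitary_left[OF that])
  also have "trace \<dots> = trace (A ** cadj A)"
    by (rule trace_mul_sym)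
  finally have "(norm (U ** A))\<^sup>2 = (norm A)\<^sup>2"
    by (simp add: norm_matrix_eq_trace)
  then show ?thesis by simp
qed

subsection \<open>The spectral theorem\<close>

text \<open>The Hermitian inner product, conjugate linear in the first argument. The library's
  \<open>inner\<close> is only its real part, which is too weak to express orthonormality of the
  columns of a unitary matrix.\<close>

definition cip :: "complex^'m \<Rightarrow> complex^'m \<Rightarrow> complex" where
  "cip x y = (\<Sum>i\<in>UNIV. cnj (x $ i) * y $ i)"

lemma cip_cadj_mult: "cip (cadj A *v x) y = cip x (A *v y)"
proof -
  have "cip (cadj A *v x) y = (\<Sum>i\<in>UNIV. \<Sum>j\<in>UNIV. A $ j $ i * cnj (x $ j) * y $ i)"
    by (simp add: cip_def matrix_vector_mult_def sum_distrib_right)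
  also have "\<dots> = (\<Sum>j\<in>UNIV. \<Sum>i\<in>UNIV. A $ j $ i * cnj (x $ j) * y $ i)"
    by (rule sum.swap)
  also have "\<dots> = cip x (A *v y)"
    by (simp add: cip_def matrix_vector_mult_def sum_distrib_left algebra_simps)
  finally show ?thesis .
qed

lemma inner_eq_Re_cip: "inner x y = Re (cip x y)"
  by (simp add: cip_def inner_vec_def inner_complex_def)

lemma quadratic_form_eq_inner:
  "Re (\<Sum>i\<in>UNIV. \<Sum>j\<in>UNIV. cnj (x $ i) * A $ i $ j * x $ j) = inner x (A *v x)"
  for A :: "complex^'m^'m"
  unfolding inner_eq_Re_cip
  by (simp only: cip_def matrix_vector_mult_def vec_lambda_beta sum_distrib_left mult.assoc)

lemma posdef_iff: "posdef A \<longleftrightarrow> hermitian A \<and> (\<forall>x. x \<noteq> 0 \<longrightarrow> inner x (A *v x) > 0)"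
  unfolding posdef_def quadratic_form_eq_inner ..

lemma inner_cadj_mult: "inner (cadj A *v x) y = inner x (A *v y)" for A :: "complex^'m^'m"
  by (simp add: inner_eq_Re_cip cip_cadj_mult)

lemma cip_add_right: "cip x (y + z) = cip x y + cip x z"
  by (simp add: cip_def algebra_simps sum.distrib)

lemma cip_scaleR_right: "cip x (r *\<^sub>R y) = of_real r * cip x y"
  by (simp add: cip_def sum_distrib_left scaleR_conv_of_real[where 'a=complex] algebra_simps)

lemma cip_scaleR_left: "cip (r *\<^sub>R x) y = of_real r * cip x y"
  by (simp add: cip_def sum_distrib_left scaleR_conv_of_real[where 'a=complex] algebra_simps)

lemma cip_self: "cip x x = of_real ((norm x)\<^sup>2)"
proof -
  have "cnj (x $ i) * x $ i = of_real ((cmod (x $ i))\<^sup>2)" for i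
    using complex_norm_square[of "x $ i"] by (simp add: mult.commute)
  then show ?thesis
    by (simp add: cip_def power2_norm_eq_inner inner_vec_def)
qed

lemma cip_commute: "cip y x = cnj (cip x y)"
  by (simp add: cip_def mult.commute)

text \<open>The next eigenvector maximises the quadratic form on the unit sphere of the orthogonal
  complement of those already found.\<close>

lemma hermitian_next_eigenvector:
  fixes A :: "complex^'m^'m" and v :: "'m \<Rightarrow> complex^'m"
  assumes A: "hermitian A" and S: "S \<noteq> UNIV"
    and eig: "\<And>s. s \<in> S \<Longrightarrow> A *v v s = l s *\<^sub>R v s"
  obtains w r where "norm w = 1" "\<And>s. s \<in> S \<Longrightarrow> cip (v s) w = 0" "A *v w = r *\<^sub>R w"
proof -
  define V where "V = {x. \<forall>s\<in>S. cip (v s) x = 0}"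
  define q where "q x = inner x (A *v x)" for x
  have sym: "inner (A *v x) y = inner x (A *v y)" for x y
    using inner_cadj_mult[of A x y] A by (simp add: hermitian_def)
  have mv_add: "A *v (x + y) = A *v x + A *v y" for x y
    by (simp add: matrix_vector_right_distrib)
  have mv_scale: "A *v (r *\<^sub>R x) = r *\<^sub>R (A *v x)" for r x
    by (simp add: vec_eq_iff matrix_vector_mult_def scaleR_sum_right)
  have lin: "linear (\<lambda>x. A *v x)"
    by (rule linearI) (simp_all add: mv_add mv_scale)
  have V_add: "x + y \<in> V" if "x \<in> V" "y \<in> V" for x y
    using that by (simp add: V_def cip_add_right)
  have V_scale: "r *\<^sub>R x \<in> V" if "x \<in> V" for x r
    using that by (simp add: V_def cip_scaleR_right)
  have V_A: "A *v x \<in> V" if "x \<in> V" for x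
  proof -
    have "cip (v s) (A *v x) = 0" if "s \<in> S" for s
      using A cip_cadj_mult[of A "v s" x] eig[OF that] \<open>x \<in> V\<close> that
      by (simp add: hermitian_def cip_scaleR_left V_def)
    then show ?thesis by (simp add: V_def)
  qed
  have "\<exists>x. x \<noteq> 0 \<and> x \<in> V"
  proof -
    \<comment> \<open>Rows outside \<open>S\<close> are zero, so \<open>B\<close> is singular; a
      nonzero kernel vector is orthogonal to every \<open>v s\<close> with \<open>s\<close> in
      \<open>S\<close>.\<close>
    define B :: "complex^'m^'m" where "B = (\<chi> i j. if i \<in> S then cnj (v i $ j) else 0)"
    obtain k where k: "k \<notin> S" using S by auto
    have "row k B = 0" using k by (simp add: B_def row_def vec_eq_iff)
    then have "det B = 0" by (rule det_zero_row)
    then have "\<not> invertible B" by (simp add: invertible_det_nz)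
    then have "\<not> (\<exists>C. C ** B = mat 1)" using invertible_left_inverse by blast
    then obtain x where x: "x \<noteq> 0" "B *v x = 0"
      using matrix_left_invertible_ker[of B] by auto
    have "cip (v s) x = 0" if "s \<in> S" for s
    proof -
      have "(B *v x) $ s = cip (v s) x"
        using that by (simp add: B_def matrix_vector_mult_def cip_def)
      then show ?thesis using x by simp
    qed
    then show ?thesis using x by (auto simp: V_def)
  qed
  then obtain x0 where x0: "x0 \<noteq> 0" "x0 \<in> V" by auto
  define K where "K = V \<inter> sphere 0 1"
  have "closed V"
  proof -
    have "continuous_on UNIV (cip (v s))" for s
      unfolding cip_def by (intro continuous_intros)
    then have "closed {x. cip (v s) x = 0}" for s
      using closed_Collect_eq[of "cip (v s)" "\<lambda>_. 0"] by simp
    then have "closed (\<Inter>s\<in>S. {x. cip (v s) x = 0})" by blast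
    moreover have "V = (\<Inter>s\<in>S. {x. cip (v s) x = 0})" by (auto simp: V_def)
    ultimately show ?thesis by simp
  qed
  then have "compact K" by (simp add: K_def closed_Int_compact)
  moreover have "(1 / norm x0) *\<^sub>R x0 \<in> K" using x0 V_scale by (simp add: K_def)
  then have "K \<noteq> {}" by auto
  moreover have "continuous_on K q"
    unfolding q_def
    by (intro continuous_intros linear_continuous_on linear_conv_bounded_linear[THEN iffD1] lin)
  ultimately obtain w where w: "w \<in> K" and wmax: "\<And>y. y \<in> K \<Longrightarrow> q y \<le> q w"
    using continuous_attains_sup by metis
  have wV: "w \<in> V" and w1: "norm w = 1" using w by (auto simp: K_def)
  have bound: "q x \<le> q w * (norm x)\<^sup>2" if "x \<in> V" for x
  proof (cases "x = 0")
    case False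
    have "(1 / norm x) *\<^sub>R x \<in> K" using False V_scale[OF that] by (simp add: K_def)
    from wmax[OF this] have "q x / (norm x)\<^sup>2 \<le> q w"
      by (simp add: q_def mv_scale power2_eq_square)
    then show ?thesis using False by (simp add: field_simps)
  qed (simp add: q_def)
  define u where "u = A *v w - q w *\<^sub>R w"
  have uV: "u \<in> V"
    using V_add[OF V_A[OF wV] V_scale[OF wV, of "- q w"]] by (simp add: u_def)
  \<comment> \<open>The residual \<open>u\<close> is itself an admissible direction. Moving from the
    maximiser \<open>w\<close> to \<open>w + t u\<close> changes the form to first order by an
    amount proportional to the squared norm of \<open>u\<close>, so letting \<open>t\<close> tend to
    0 from the right forces \<open>u = 0\<close>.\<close>
  have key: "2 * (norm u)\<^sup>2 \<le> t * (q w * (norm u)\<^sup>2 - q u)" if "t > 0" for t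
  proof -
    have 1: "q (w + t *\<^sub>R u) \<le> q w * (norm (w + t *\<^sub>R u))\<^sup>2"
      by (intro bound V_add V_scale wV uV)
    have 2: "q (w + t *\<^sub>R u) = q w + 2 * t * inner u (A *v w) + t\<^sup>2 * q u"
    proof -
      have "inner w (A *v u) = inner u (A *v w)"
        using sym[of w u] by (simp add: inner_commute)
      then show ?thesis
        by (simp add: q_def mv_add mv_scale inner_add_left inner_add_right power2_eq_square
            algebra_simps)
    qed
    have 3: "(norm (w + t *\<^sub>R u))\<^sup>2 = 1 + 2 * t * inner u w + t\<^sup>2 * (norm u)\<^sup>2"
    proof -
      have "inner w w = 1" using w1 by (simp add: norm_eq_1)
      then show ?thesis
        unfolding power2_norm_eq_inner
        by (simp add: inner_add_left inner_add_right inner_commute[of w u] power2_eq_square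
            algebra_simps)
    qed
    have 4: "inner u (A *v w) = (norm u)\<^sup>2 + q w * inner u w"
    proof -
      have "inner u u = inner u (A *v w) - q w * inner u w"
        by (subst (2) u_def) (simp add: inner_diff_right)
      then show ?thesis by (simp add: power2_norm_eq_inner)
    qed
    have "2 * t * (norm u)\<^sup>2 \<le> t\<^sup>2 * (q w * (norm u)\<^sup>2 - q u)"
      using 1 unfolding 2 3 4 by (simp add: algebra_simps)
    then have "t * (2 * (norm u)\<^sup>2) \<le> t * (t * (q w * (norm u)\<^sup>2 - q u))"
      by (simp add: algebra_simps power2_eq_square)
    then show ?thesis using that by simp
  qed
  have "((\<lambda>t. t * (q w * (norm u)\<^sup>2 - q u)) \<longlongrightarrow> 0 * (q w * (norm u)\<^sup>2 - q u)) (at_right 0)"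
    by (intro tendsto_intros)
  then have "2 * (norm u)\<^sup>2 \<le> 0 * (q w * (norm u)\<^sup>2 - q u)"
    by (rule tendsto_lowerbound) (auto simp: key eventually_at_right_less intro: eventually_at_rightI[of 0 1])
  then have "u = 0" by simp
  then have "A *v w = q w *\<^sub>R w" by (simp add: u_def)
  with w1 wV that show thesis by (auto simp: V_def)
qed

text \<open>The induction adds one index of the type \<open>'m\<close> at a time, so the
  eigenvectors end up indexed by \<open>'m\<close> itself and are directly the columns of
  \<open>U\<close>.\<close>

lemma hermitian_spectral:
  fixes A :: "complex^'m^'m"
  assumes A: "hermitian A"
  obtains U l where "unitary U" "A = U ** diagm l ** cadj U"
proof -
  have "\<exists>v l. (\<forall>s\<in>S. \<forall>t\<in>S. cip (v s) (v t) = (if s = t then 1 else 0)) \<and>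
      (\<forall>s\<in>S. A *v v s = l s *\<^sub>R v s)" if "finite S" for S :: "'m set"
    using that
  proof (induction S rule: finite_induct)
    case (insert a S)
    then obtain v l where ort: "\<And>s t. s \<in> S \<Longrightarrow> t \<in> S \<Longrightarrow> cip (v s) (v t) = (if s = t then 1 else 0)"
      and eig: "\<And>s. s \<in> S \<Longrightarrow> A *v v s = l s *\<^sub>R v s" by blast
    have "S \<noteq> UNIV" using insert by auto
    then obtain w r where w: "norm w = 1" "\<And>s. s \<in> S \<Longrightarrow> cip (v s) w = 0" "A *v w = r *\<^sub>R w"
      using hermitian_next_eigenvector[where S = S and v = v and l = l, OF A _ eig] by blast
    have w': "cip w (v s) = 0" if "s \<in> S" for s
      using w(2)[OF that] cip_commute[of w "v s"] by simp
    have ww: "cip w w = 1" using w by (simp add: cip_self)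
    show ?case
      using insert.hyps ort eig w w' ww
      by (intro exI[of _ "v(a := w)"] exI[of _ "l(a := r)"]) auto
  qed auto
  from this[of UNIV] obtain v :: "'m \<Rightarrow> complex^'m" and l where
    ort: "\<And>s t. cip (v s) (v t) = (if s = t then 1 else 0)"
    and eig: "\<And>s. A *v v s = l s *\<^sub>R v s" by auto
  define U :: "complex^'m^'m" where "U = (\<chi> i j. v j $ i)"
  have U: "unitary U"
    unfolding unitary_def using ort
    by (simp add: vec_eq_iff matrix_matrix_mult_def U_def mat_def cip_def)
  have "(A ** U) $ i $ j = (U ** diagm l) $ i $ j" for i j
  proof -
    have "(A ** U) $ i $ j = (A *v v j) $ i"
      by (simp add: matrix_matrix_mult_def matrix_vector_mult_def U_def)
    then show ?thesis
      by (simp add: eig mult_diagm_nth U_def scaleR_conv_of_real[where 'a=complex])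
  qed
  then have "A ** U = U ** diagm l" by (simp add: vec_eq_iff)
  then have "U ** diagm l ** cadj U = A ** (U ** cadj U)"
    by (simp add: matrix_mul_assoc)
  then have "A = U ** diagm l ** cadj U" by (simp add: unitary_right[OF U])
  with U that show thesis by blast
qed

subsection \<open>Functional calculus\<close>

definition udiag :: "complex^'m^'m \<Rightarrow> ('m \<Rightarrow> real) \<Rightarrow> complex^'m^'m" where
  "udiag U l = U ** diagm l ** cadj U"

lemma cadj_udiag [simp]: "cadj (udiag U l) = udiag U l"
  by (simp add: udiag_def cadj_mult matrix_mul_assoc)

lemma hermitian_udiag: "hermitian (udiag U l)"
  by (simp add: hermitian_def)

lemma udiag_mult_right: "unitary U \<Longrightarrow> udiag U l ** U = U ** diagm l"
  by (simp add: udiag_def matrix_mul_assoc[symmetric] unitary_left)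

lemma udiag_mult_left: "unitary U \<Longrightarrow> cadj U ** udiag U l = diagm l ** cadj U"
  by (simp add: udiag_def matrix_mul_assoc unitary_left)

lemma udiag_mult: "udiag U a ** udiag U b = udiag U (\<lambda>i. a i * b i)" if "unitary U"
proof -
  have "udiag U a ** udiag U b = (udiag U a ** U) ** diagm b ** cadj U"
    by (simp add: udiag_def[of U b] matrix_mul_assoc)
  also have "\<dots> = U ** (diagm a ** diagm b) ** cadj U"
    by (simp add: udiag_mult_right[OF that] matrix_mul_assoc)
  finally show ?thesis by (simp add: udiag_def diagm_mult_diagm)
qed

lemma udiag_1: "unitary U \<Longrightarrow> udiag U (\<lambda>i. 1) = mat 1"
  by (simp add: udiag_def unitary_right)

lemma udiag_scaleR: "udiag U (\<lambda>i. r * l i) = r *\<^sub>R udiag U l"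
proof -
  have "diagm (\<lambda>i. r * l i) = r *\<^sub>R diagm l"
    by (simp add: vec_eq_iff diagm_def scaleR_conv_of_real[where 'a=complex])
  then show ?thesis
    by (simp add: udiag_def matrix_mult_scaleR_left matrix_mult_scaleR_right)
qed

lemma udiag_diff: "udiag U (\<lambda>i. a i - b i) = udiag U a - udiag U b"
proof -
  have "diagm (\<lambda>i. a i - b i) = diagm a - diagm b"
    by (simp add: vec_eq_iff diagm_def)
  then show ?thesis
    by (simp add: udiag_def matrix_mult_diff_left matrix_mult_diff_right)
qed

lemma trace_udiag: "trace (udiag U l) = of_real (\<Sum>i\<in>UNIV. l i)" if "unitary U"
proof -
  have "trace (udiag U l) = trace (cadj U ** (U ** diagm l))"
    unfolding udiag_def by (rule trace_mul_sym)
  also have "\<dots> = trace (diagm l)"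
    by (simp add: matrix_mul_assoc unitary_left[OF that])
  finally show ?thesis by (simp add: trace_def diagm_def)
qed

lemma inner_udiag: "inner x (udiag U l *v x) = (\<Sum>i\<in>UNIV. l i * (cmod ((cadj U *v x) $ i))\<^sup>2)"
proof -
  have "inner x (udiag U l *v x) = inner (cadj U *v x) (diagm l *v (cadj U *v x))"
    by (simp add: inner_cadj_mult udiag_def matrix_vector_mul_assoc matrix_mul_assoc)
  moreover have "(diagm l *v y) $ i = of_real (l i) * y $ i" for y :: "complex^'a" and i
    by (simp add: matrix_vector_mult_def diagm_def if_distrib[of "\<lambda>x. x * _"] cong: if_cong)
  moreover have "inner c (of_real r * c) = r * (cmod c)\<^sup>2" for c :: complex and r
    by (simp only: cmod_power2) (simp add: inner_complex_def power2_eq_square algebra_simps)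
  ultimately show ?thesis by (simp add: inner_vec_def)
qed

lemma posdef_udiag_iff: "posdef (udiag U l) \<longleftrightarrow> (\<forall>i. l i > 0)" if U: "unitary U"
proof
  assume *: "posdef (udiag U l)"
  show "\<forall>i. l i > 0"
  proof
    fix i
    define x :: "complex^'a" where "x = U *v axis i 1"
    have Ux: "cadj U *v x = axis i 1"
      by (simp add: x_def matrix_vector_mul_assoc unitary_left[OF U])
    then have "x \<noteq> 0" by (auto simp: axis_eq_0_iff)
    then have "0 < inner x (udiag U l *v x)" using * by (simp add: posdef_iff)
    also have "\<dots> = (\<Sum>j\<in>UNIV. if j = i then l i else 0)"
      unfolding inner_udiag Ux by (intro sum.cong) (auto simp: axis_def)
    finally show "l i > 0" by simp
  qed
next
  assume *: "\<forall>i. l i > 0"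
  have "inner x (udiag U l *v x) > 0" if "x \<noteq> 0" for x
  proof -
    have "U *v (cadj U *v x) = x"
      by (simp add: matrix_vector_mul_assoc unitary_right[OF U])
    then have "cadj U *v x \<noteq> 0" using that by auto
    then obtain i where "(cadj U *v x) $ i \<noteq> 0" by (auto simp: vec_eq_iff)
    then show ?thesis unfolding inner_udiag using *
      by (intro sum_pos2[of _ i]) (auto simp: less_imp_le)
  qed
  then show "posdef (udiag U l)" by (simp add: posdef_iff hermitian_udiag)
qed

lemma hermitian_udiagE:
  assumes "hermitian A"
  obtains U l where "unitary U" "A = udiag U l"
  using hermitian_spectral[OF assms] unfolding udiag_def by metis

lemma posdef_hermitian: "posdef A \<Longrightarrow> hermitian A"
  by (simp add: posdef_def)

lemma posdef_udiagE:
  assumes "posdef A"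
  obtains U l where "unitary U" "\<And>i. l i > 0" "A = udiag U l"
  by (metis assms hermitian_udiagE posdef_hermitian posdef_udiag_iff)

text \<open>In the two eigenbases the hypothesis reads d_i W_ij = W_ij e_j. Where W_ij is nonzero
  the eigenvalues agree, hence so do their images under \<open>f\<close>. With \<open>S\<close> the
  identity this gives well-definedness of the functional calculus, with \<open>S\<close> unitary its
  invariance under change of basis.\<close>

lemma udiag_intertwine:
  assumes U: "unitary U" and V: "unitary V" and eq: "udiag U d ** S = S ** udiag V e"
  shows "udiag U (\<lambda>i. f (d i)) ** S = S ** udiag V (\<lambda>i. f (e i))"
proof -
  define W where "W = cadj U ** S ** V"
  have W: "udiag U a ** S = S ** udiag V b \<longleftrightarrow> diagm a ** W = W ** diagm b" for a b
  proof -
    have 1: "cadj U ** (udiag U a ** S) ** V = diagm a ** W"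
      by (simp add: W_def matrix_mul_assoc udiag_mult_left[OF U])
    have 2: "cadj U ** (S ** udiag V b) ** V = W ** diagm b"
      by (simp add: W_def matrix_mul_assoc[symmetric] udiag_mult_right[OF V])
    have 3: "U ** (cadj U ** X ** V) ** cadj V = X" for X
    proof -
      have "U ** (cadj U ** X ** V) ** cadj V = (U ** cadj U) ** X ** (V ** cadj V)"
        by (simp add: matrix_mul_assoc)
      then show ?thesis by (simp add: unitary_right[OF U] unitary_right[OF V])
    qed
    show ?thesis using 1 2 3 by metis
  qed
  have "diagm d ** W = W ** diagm e" using eq W by simp
  then have *: "of_real (d i) * W $ i $ j = W $ i $ j * of_real (e j)" for i j
    by (simp add: diagm_mult_nth[symmetric] mult_diagm_nth[symmetric])
  have "of_real (f (d i)) * W $ i $ j = W $ i $ j * of_real (f (e j))" for i j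
    using *[of i j] by (cases "W $ i $ j = 0") auto
  then have "diagm (\<lambda>i. f (d i)) ** W = W ** diagm (\<lambda>i. f (e i))"
    by (simp add: vec_eq_iff diagm_mult_nth mult_diagm_nth)
  then show ?thesis using W by simp
qed

lemma mfun_udiag:
  assumes U: "unitary U" and l: "\<And>i. l i > 0"
  shows "mfun f (udiag U l) = udiag U (\<lambda>i. f (l i))"
proof -
  have pd: "posdef (udiag U l)" using posdef_udiag_iff[OF U] l by simp
  define P where "P B \<longleftrightarrow> (\<exists>V e. unitary V \<and> (\<forall>i. e i > 0) \<and> udiag U l = V ** diagm e ** cadj V \<and>
                    B = V ** diagm (\<lambda>i. f (e i)) ** cadj V)" for B
  have "P (udiag U (\<lambda>i. f (l i)))"
    unfolding P_def udiag_def using U l by blast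
  \<comment> \<open>Two diagonalisations of the same matrix are intertwined by the identity, so the
    choice made by \<open>SOME\<close> does not matter.\<close>
  moreover have "B = udiag U (\<lambda>i. f (l i))" if B: "P B" for B
  proof -
    obtain V e where V: "unitary V" "udiag U l = udiag V e" "B = udiag V (\<lambda>i. f (e i))"
      using B unfolding P_def udiag_def[symmetric] by blast
    then have "udiag U l ** mat 1 = mat 1 ** udiag V e" by simp
    from udiag_intertwine[OF U V(1) this, of f] show ?thesis using V by simp
  qed
  ultimately have "(SOME B. P B) = udiag U (\<lambda>i. f (l i))"
    by (metis someI)
  then show ?thesis using pd by (simp add: mfun_def P_def)
qed

lemma mfun_intertwine:
  assumes "posdef A" "posdef B" "A ** S = S ** B"
  shows "mfun f A ** S = S ** mfun f B"
proof -
  obtain U d where U: "unitary U" "\<And>i. d i > 0" "A = udiag U d"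
    using assms(1) by (rule posdef_udiagE) auto
  obtain V e where V: "unitary V" "\<And>i. e i > 0" "B = udiag V e"
    using assms(2) by (rule posdef_udiagE) auto
  have "udiag U d ** S = S ** udiag V e" using assms(3) U(3) V(3) by simp
  from udiag_intertwine[OF U(1) V(1) this, of f] show ?thesis
    by (simp add: mfun_udiag U V)
qed

lemma cadj_mfun: "posdef A \<Longrightarrow> cadj (mfun f A) = mfun f A"
  by (metis posdef_udiagE mfun_udiag cadj_udiag)

lemma mfun_mult: "posdef A \<Longrightarrow> mfun f A ** mfun g A = mfun (\<lambda>x. f x * g x) A"
  by (erule posdef_udiagE) (simp add: mfun_udiag udiag_mult)

lemma posdef_mfun: "posdef A \<Longrightarrow> (\<And>x. x > 0 \<Longrightarrow> f x > 0) \<Longrightarrow> posdef (mfun f A)"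
  by (erule posdef_udiagE) (simp add: mfun_udiag posdef_udiag_iff)

lemma mfun_mfun: "posdef A \<Longrightarrow> (\<And>x. x > 0 \<Longrightarrow> g x > 0) \<Longrightarrow> mfun f (mfun g A) = mfun (\<lambda>x. f (g x)) A"
  by (erule posdef_udiagE) (simp add: mfun_udiag)

lemma mfun_cong: "posdef A \<Longrightarrow> (\<And>x. x > 0 \<Longrightarrow> f x = g x) \<Longrightarrow> mfun f A = mfun g A"
  by (erule posdef_udiagE) (simp add: mfun_udiag)

lemma mfun_scaleR: "posdef A \<Longrightarrow> mfun (\<lambda>x. r * f x) A = r *\<^sub>R mfun f A"
  by (erule posdef_udiagE) (simp add: mfun_udiag udiag_scaleR)

lemma mfun_1: "posdef A \<Longrightarrow> mfun (\<lambda>x. 1) A = mat 1"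
  by (erule posdef_udiagE) (simp add: mfun_udiag udiag_1)

lemma mfun_ident: "posdef A \<Longrightarrow> mfun (\<lambda>x. x) A = A"
  by (erule posdef_udiagE) (simp add: mfun_udiag)

lemma posdef_mpow: "posdef A \<Longrightarrow> posdef (mpow A t)"
  unfolding mpow_def by (rule posdef_mfun) auto

lemma cadj_mpow: "posdef A \<Longrightarrow> cadj (mpow A t) = mpow A t"
  unfolding mpow_def by (rule cadj_mfun)

lemma cadj_mlog: "posdef A \<Longrightarrow> cadj (mlog A) = mlog A"
  unfolding mlog_def by (rule cadj_mfun)

lemma mpow_add: "posdef A \<Longrightarrow> mpow A s ** mpow A t = mpow A (s + t)"
  unfolding mpow_def by (simp add: mfun_mult powr_add)

lemma mpow_0 [simp]: "posdef A \<Longrightarrow> mpow A 0 = mat 1"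
  unfolding mpow_def by (rule trans[OF mfun_cong mfun_1]) auto

lemma mpow_1 [simp]: "posdef A \<Longrightarrow> mpow A 1 = A"
  unfolding mpow_def by (rule trans[OF mfun_cong mfun_ident]) auto

lemma mpow_mpow: "posdef A \<Longrightarrow> mpow (mpow A s) t = mpow A (s * t)"
  unfolding mpow_def by (simp add: mfun_mfun powr_powr)

lemma mlog_mpow: "posdef A \<Longrightarrow> mlog (mpow A t) = t *\<^sub>R mlog A"
proof -
  assume A: "posdef A"
  have "mlog (mpow A t) = mfun (\<lambda>x. ln (x powr t)) A"
    unfolding mpow_def mlog_def using A by (simp add: mfun_mfun)
  also have "\<dots> = mfun (\<lambda>x. t * ln x) A"
    by (rule mfun_cong[OF A]) (simp add: ln_powr)
  finally show ?thesis by (simp add: mfun_scaleR[OF A] mlog_def)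
qed

lemma mpow_cancel: "posdef A \<Longrightarrow> s + t = 0 \<Longrightarrow> mpow A s ** mpow A t = mat 1"
  by (simp add: mpow_add)

lemma mat_1_udiag: "mat 1 = udiag (mat 1) (\<lambda>i. 1)" and unitary_mat_1: "unitary (mat 1)"
  by (simp_all add: udiag_def unitary_def)

lemma posdef_mat_1: "posdef (mat 1)"
  by (subst mat_1_udiag) (simp add: posdef_udiag_iff[OF unitary_mat_1])

lemma mpow_mat_1 [simp]: "mpow (mat 1) t = mat 1"
  unfolding mpow_def by (simp add: mfun_udiag[OF unitary_mat_1, of "\<lambda>_. 1",
        unfolded udiag_1[OF unitary_mat_1]] udiag_1[OF unitary_mat_1])

lemma mlog_mat_1 [simp]: "mlog (mat 1) = 0"
  using mlog_mpow[OF posdef_mat_1, of 0] by simp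

lemma posdef_congr:
  assumes "posdef A" "posdef C"
  shows "posdef (C ** A ** C)"
proof -
  have C: "cadj C = C" and A: "cadj A = A"
    using assms by (simp_all add: posdef_def hermitian_def)
  have "inner x ((C ** A ** C) *v x) > 0" if "x \<noteq> 0" for x
  proof -
    have "inner x (C *v x) > 0" using assms that by (simp add: posdef_iff)
    then have "C *v x \<noteq> 0" by auto
    then have "inner (C *v x) (A *v (C *v x)) > 0" using assms by (simp add: posdef_iff)
    also have "inner (C *v x) (A *v (C *v x)) = inner x (C *v (A *v (C *v x)))"
      using inner_cadj_mult[of C x] C by simp
    finally show ?thesis by (simp add: matrix_vector_mul_assoc matrix_mul_assoc)
  qed
  then show ?thesis
    using A C by (simp add: posdef_iff hermitian_def cadj_mult matrix_mul_assoc)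
qed

lemma hermitian_eq_mlog:
  assumes "hermitian H"
  obtains A where "posdef A" "mlog A = H"
proof -
  obtain U l where U: "unitary U" "H = udiag U l" using assms by (rule hermitian_udiagE)
  show thesis
    by (rule that[of "udiag U (\<lambda>i. exp (l i))"])
      (simp_all add: U posdef_udiag_iff mlog_def mfun_udiag)
qed

subsection \<open>Norm estimates\<close>

text \<open>The squared moduli of the entries of a unitary matrix are doubly stochastic. They serve
  as the weights whenever two spectra are compared below.\<close>

lemma
  assumes "unitary W"
  shows sum_cmod_unitary_row: "(\<Sum>j\<in>UNIV. (cmod (W $ i $ j))\<^sup>2) = 1"
    and sum_cmod_unitary_col: "(\<Sum>i\<in>UNIV. (cmod (W $ i $ j))\<^sup>2) = 1"
proof -
  have "complex_of_real (\<Sum>j\<in>UNIV. (cmod (W $ i $ j))\<^sup>2) = (W ** cadj W) $ i $ i"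
    by (simp only: of_real_sum complex_norm_square matrix_matrix_mult_def vec_lambda_beta cadj_nth)
  also have "\<dots> = 1" by (simp add: unitary_right[OF assms] mat_def)
  finally show "(\<Sum>j\<in>UNIV. (cmod (W $ i $ j))\<^sup>2) = 1" by (simp only: of_real_eq_1_iff)
  have "complex_of_real (\<Sum>i\<in>UNIV. (cmod (W $ i $ j))\<^sup>2) = (cadj W ** W) $ j $ j"
    by (simp only: of_real_sum complex_norm_square matrix_matrix_mult_def vec_lambda_beta cadj_nth
        mult.commute)
  also have "\<dots> = 1" by (simp add: unitary_left[OF assms] mat_def)
  finally show "(\<Sum>i\<in>UNIV. (cmod (W $ i $ j))\<^sup>2) = 1" by (simp only: of_real_eq_1_iff)
qed

text \<open>Multiplying by \<open>cadj U\<close> on the left and by \<open>V\<close> on the right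
  preserves the norm and turns the difference into the matrix with entries (d_i - e_j) W_ij.\<close>

lemma norm_udiag_diff:
  assumes U: "unitary U" and V: "unitary V"
  shows "(norm (udiag U d - udiag V e))\<^sup>2 =
    (\<Sum>i\<in>UNIV. \<Sum>j\<in>UNIV. (d i - e j)\<^sup>2 * (cmod ((cadj U ** V) $ i $ j))\<^sup>2)"
proof -
  define W where "W = cadj U ** V"
  have "norm (udiag U d - udiag V e) = norm (cadj U ** (udiag U d - udiag V e) ** V)"
    by (simp add: norm_mult_unitary[OF V] norm_unitary_mult[OF unitary_cadj[OF U]])
  also have "cadj U ** (udiag U d - udiag V e) ** V = diagm d ** W - W ** diagm e"
  proof -
    have "cadj U ** udiag U d ** V = diagm d ** W"
      by (simp add: W_def matrix_mul_assoc udiag_mult_left[OF U])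
    moreover have "cadj U ** udiag V e ** V = W ** diagm e"
      by (simp add: W_def matrix_mul_assoc[symmetric] udiag_mult_right[OF V])
    ultimately show ?thesis
      by (simp add: matrix_mult_diff_left matrix_mult_diff_right)
  qed
  finally have "(norm (udiag U d - udiag V e))\<^sup>2 =
      (\<Sum>i\<in>UNIV. \<Sum>j\<in>UNIV. (cmod ((d i - e j) * W $ i $ j))\<^sup>2)"
    by (simp add: norm_matrix_power2 diagm_mult_nth mult_diagm_nth algebra_simps)
  also have "\<dots> = (\<Sum>i\<in>UNIV. \<Sum>j\<in>UNIV. (d i - e j)\<^sup>2 * (cmod (W $ i $ j))\<^sup>2)"
    by (simp add: norm_mult power_mult_distrib flip: of_real_diff)
  finally show ?thesis by (simp add: W_def)
qed

lemma norm_udiag: "(norm (udiag U d))\<^sup>2 = (\<Sum>i\<in>UNIV. (d i)\<^sup>2)" if U: "unitary U"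
proof -
  have "udiag U d ** cadj (udiag U d) = udiag U (\<lambda>i. d i * d i)"
    by (simp add: udiag_mult[OF U])
  then show ?thesis
    unfolding norm_matrix_eq_trace by (simp add: trace_udiag[OF U] power2_eq_square)
qed

text \<open>The weights are the same as in \<open>norm_udiag_diff\<close>, which is what allows
  traces and norms to be compared term by term.\<close>

lemma trace_udiag_mult:
  assumes U: "unitary U" and V: "unitary V"
  shows "Re (trace (udiag U d ** udiag V e)) =
    (\<Sum>i\<in>UNIV. \<Sum>j\<in>UNIV. d i * e j * (cmod ((cadj U ** V) $ i $ j))\<^sup>2)"
proof -
  define W where "W = cadj U ** V"
  have "trace (udiag U d ** udiag V e) = trace (U ** (diagm d ** W ** diagm e ** cadj V))"
    by (simp add: udiag_def W_def matrix_mul_assoc)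
  also have "\<dots> = trace ((diagm d ** W ** diagm e ** cadj V) ** U)"
    by (rule trace_mul_sym)
  also have "(diagm d ** W ** diagm e ** cadj V) ** U = diagm d ** (W ** diagm e ** cadj W)"
    by (simp add: W_def matrix_mul_assoc cadj_mult)
  finally have "Re (trace (udiag U d ** udiag V e)) =
      Re (\<Sum>i\<in>UNIV. d i * (\<Sum>j\<in>UNIV. W $ i $ j * of_real (e j) * cnj (W $ i $ j)))"
    by (simp add: trace_def diagm_mult_nth matrix_matrix_mult_def[of "W ** diagm e"] mult_diagm_nth)
  also have "\<dots> = (\<Sum>i\<in>UNIV. \<Sum>j\<in>UNIV. Re (d i * (W $ i $ j * of_real (e j) * cnj (W $ i $ j))))"
    by (simp add: sum_distrib_left)
  also have "\<dots> = (\<Sum>i\<in>UNIV. \<Sum>j\<in>UNIV. d i * e j * (cmod (W $ i $ j))\<^sup>2)"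
    by (intro sum.cong refl, simp only: cmod_power2) (simp add: power2_eq_square algebra_simps)
  finally show ?thesis by (simp add: W_def)
qed

text \<open>The weights in column \<open>j\<close> sum to 1, so the smallest (d_i - e_j)^2 is at
  most their weighted mean, and that mean is part of the double sum for the squared norm.\<close>

lemma udiag_eigenvalue_perturbation:
  assumes U: "unitary U" and V: "unitary V"
  shows "\<exists>i. \<bar>d i - e j\<bar> \<le> norm (udiag U d - udiag V e)"
proof -
  define W where "W = cadj U ** V"
  have W: "unitary W" by (simp add: W_def U V unitary_cadj unitary_mult)
  obtain k where k: "\<And>i. (d k - e j)\<^sup>2 \<le> (d i - e j)\<^sup>2"
    using ex_min_if_finite[of "range (\<lambda>i. (d i - e j)\<^sup>2)"] by (force simp: not_less)
  have "(d k - e j)\<^sup>2 = (\<Sum>i\<in>UNIV. (d k - e j)\<^sup>2 * (cmod (W $ i $ j))\<^sup>2)"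
    by (simp add: sum_distrib_left[symmetric] sum_cmod_unitary_col[OF W])
  also have "\<dots> \<le> (\<Sum>i\<in>UNIV. (d i - e j)\<^sup>2 * (cmod (W $ i $ j))\<^sup>2)"
    by (intro sum_mono mult_right_mono k) auto
  also have "\<dots> \<le> (\<Sum>i\<in>UNIV. \<Sum>j\<in>UNIV. (d i - e j)\<^sup>2 * (cmod (W $ i $ j))\<^sup>2)"
    by (intro sum_mono member_le_sum) auto
  also have "\<dots> = (norm (udiag U d - udiag V e))\<^sup>2"
    by (simp add: norm_udiag_diff[OF U V] W_def)
  finally have "\<bar>d k - e j\<bar> \<le> norm (udiag U d - udiag V e)"
    by (simp add: abs_le_square_iff[symmetric])
  then show ?thesis ..
qed

text \<open>In the Frobenius norm a scalar Lipschitz bound between the spectra passes to matrices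
  with the same constant.\<close>

lemma norm_udiag_diff_mono:
  assumes U: "unitary U" and V: "unitary V" and C: "C \<ge> 0"
    and le: "\<And>i j. \<bar>a i - b j\<bar> \<le> C * \<bar>d i - e j\<bar>"
  shows "norm (udiag U a - udiag V b) \<le> C * norm (udiag U d - udiag V e)"
proof -
  have *: "(a i - b j)\<^sup>2 \<le> C\<^sup>2 * (d i - e j)\<^sup>2" for i j
    using power_mono[OF le[of i j] abs_ge_zero, of 2] by (simp add: power_mult_distrib)
  have "(norm (udiag U a - udiag V b))\<^sup>2 \<le>
    (\<Sum>i\<in>UNIV. \<Sum>j\<in>UNIV. C\<^sup>2 * ((d i - e j)\<^sup>2 * (cmod ((cadj U ** V) $ i $ j))\<^sup>2))"
    unfolding norm_udiag_diff[OF U V] mult.assoc[symmetric]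
    by (intro sum_mono mult_right_mono *) auto
  also have "\<dots> = (C * norm (udiag U d - udiag V e))\<^sup>2"
    by (simp add: power_mult_distrib norm_udiag_diff[OF U V] sum_distrib_left)
  finally show ?thesis
    by (rule power2_le_imp_le) (simp add: C)
qed

lemma posdef_near:
  assumes "posdef A"
  obtains a b where "0 < a"
    "\<And>B. hermitian B \<Longrightarrow> norm (B - A) < a \<Longrightarrow> posdef B"
    "\<And>V e B i. unitary V \<Longrightarrow> B = udiag V e \<Longrightarrow> norm (B - A) < a \<Longrightarrow> a \<le> e i \<and> e i \<le> b"
proof -
  obtain U d where U: "unitary U" "\<And>i. d i > 0" "A = udiag U d"
    using assms by (rule posdef_udiagE) auto
  \<comment> \<open>Half the smallest eigenvalue: a perturbation below \<open>a\<close> moves each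
    eigenvalue by less than \<open>a\<close> from some \<open>d k\<close>, so it stays at least
    \<open>a\<close>, and at most \<open>b\<close>.\<close>
  define a where "a = Min (range d) / 2"
  define b where "b = Max (range d) + a"
  have "Min (range d) \<in> range d" by (intro Min_in) auto
  then have a0: "a > 0" using U(2) by (auto simp: a_def)
  have range: "2 * a \<le> d i" "d i + a \<le> b" for i
    by (simp_all add: a_def b_def)
  have near: "a \<le> e i \<and> e i \<le> b"
    if V: "unitary V" "B = udiag V e" "norm (B - A) < a" for V e B i
  proof -
    obtain k where "\<bar>d k - e i\<bar> \<le> norm (A - B)"
      using udiag_eigenvalue_perturbation[OF U(1) V(1), of d e i] U V by auto
    then have "\<bar>d k - e i\<bar> < a" using V by (simp add: norm_minus_commute)
    then show ?thesis using range[of k] by linarith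
  qed
  have "posdef B" if B: "hermitian B" "norm (B - A) < a" for B
  proof -
    obtain V e where V: "unitary V" "B = udiag V e" using B(1) by (rule hermitian_udiagE)
    have "e i > 0" for i using near[OF V B(2), of i] a0 by linarith
    then show ?thesis using V posdef_udiag_iff by auto
  qed
  with that a0 near show thesis by blast
qed

section \<open>Continuity and measurability of the functional calculus\<close>

text \<open>Near a given matrix all spectra lie in one interval [a, b] with a > 0. There the
  derivative is bounded, and the resulting scalar Lipschitz bound is transferred by
  \<open>norm_udiag_diff_mono\<close>.\<close>

lemma mfun_continuous_on:
  assumes der: "\<And>x. x > 0 \<Longrightarrow> (f has_real_derivative f' x) (at x)"
    and cont: "continuous_on {0<..} f'"
  shows "continuous_on PD (mfun f :: complex^'m^'m \<Rightarrow> complex^'m^'m)"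
  unfolding continuous_on_def
proof
  fix A :: "complex^'m^'m" assume "A \<in> PD"
  then have A: "posdef A" by (simp add: PD_def)
  obtain a b where a: "0 < a" and
    near: "\<And>V e B i. unitary V \<Longrightarrow> B = udiag V e \<Longrightarrow> norm (B - A) < a \<Longrightarrow> a \<le> e i \<and> e i \<le> b"
    using posdef_near[OF A] by metis
  have "compact (f' ` {a..b})"
    by (rule compact_continuous_image) (use a in \<open>auto intro: continuous_on_subset[OF cont]\<close>)
  then obtain C where C: "C > 0" "\<And>x. x \<in> {a..b} \<Longrightarrow> norm (f' x) \<le> C"
    using compact_imp_bounded bounded_pos by (metis (no_types, lifting) imageI)
  have lip: "\<bar>f x - f y\<bar> \<le> C * \<bar>x - y\<bar>" if "x \<in> {a..b}" "y \<in> {a..b}" for x y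
  proof -
    have "(f has_field_derivative f' z) (at z within {a..b})" if "z \<in> {a..b}" for z
      using that a by (intro has_field_derivative_at_within[OF der]) simp
    then show ?thesis
      using field_differentiable_bound[of "{a..b}" f f' C x y] that C by simp
  qed
  obtain U d where U: "unitary U" "\<And>i. d i > 0" "A = udiag U d"
    using A by (rule posdef_udiagE) auto
  have "norm (mfun f B - mfun f A) \<le> C * norm (B - A)"
    if B: "B \<in> PD" "norm (B - A) < a" for B
  proof -
    have "posdef B" using B by (simp add: PD_def)
    then obtain V e where V: "unitary V" "\<And>i. e i > 0" "B = udiag V e"
      by (rule posdef_udiagE) auto
    have "norm (udiag V (\<lambda>i. f (e i)) - udiag U (\<lambda>i. f (d i))) \<le> C * norm (udiag V e - udiag U d)"
      using near[OF V(1) V(3) B(2)] near[OF U(1) U(3)] a C U V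
      by (intro norm_udiag_diff_mono lip) auto
    then show ?thesis
      using mfun_udiag[OF U(1,2), of f] mfun_udiag[OF V(1,2), of f] U(3) V(3) by simp
  qed
  moreover have "eventually (\<lambda>B. B \<in> PD \<and> norm (B - A) < a) (at A within PD)"
    unfolding eventually_at dist_norm using a by blast
  ultimately have "eventually (\<lambda>B. norm (mfun f B - mfun f A) \<le> norm (B - A) * C) (at A within PD)"
    by (auto elim!: eventually_mono simp: mult.commute)
  moreover have "((\<lambda>B. B - A) \<longlongrightarrow> 0) (at A within PD)"
    by (rule tendsto_eq_intros | simp)+
  ultimately have "((\<lambda>B. mfun f B - mfun f A) \<longlongrightarrow> 0) (at A within PD)"
    by (rule tendsto_0_le[rotated])
  then show "(mfun f \<longlongrightarrow> mfun f A) (at A within PD)"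
    by (simp add: LIM_zero_iff)
qed

lemma mlog_continuous_on: "continuous_on PD mlog"
  unfolding mlog_def
  by (rule mfun_continuous_on[where f' = inverse])
    (auto intro!: derivative_eq_intros continuous_intros simp: divide_inverse)

lemma mpow_continuous_on: "continuous_on PD (\<lambda>A. mpow A t)"
  unfolding mpow_def
  by (rule mfun_continuous_on[where f' = "\<lambda>x. t * x powr (t - 1)"])
    (auto intro!: derivative_eq_intros continuous_intros)

lemma closed_hermitian: "closed {A :: complex^'m^'m. hermitian A}"
  unfolding hermitian_def
  by (intro closed_Collect_eq continuous_intros linear_continuous_on bounded_linear_cadj)

text \<open>Positive definiteness is an open condition only inside the Hermitian matrices, so
  \<open>PD\<close> is exhibited as the intersection of a closed and an open set.\<close>

lemma PD_borel [measurable]: "(PD :: (complex^'m^'m) set) \<in> sets borel"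
proof -
  have "\<forall>A\<in>PD. \<exists>a>0. \<forall>B :: complex^'m^'m. hermitian B \<longrightarrow> norm (B - A) < a \<longrightarrow> posdef B"
    by (metis PD_def mem_Collect_eq posdef_near)
  then obtain r where r: "\<And>A :: complex^'m^'m. A \<in> PD \<Longrightarrow> r A > 0"
    "\<And>A B. A \<in> PD \<Longrightarrow> hermitian B \<Longrightarrow> norm (B - A) < r A \<Longrightarrow> posdef B" by metis
  have "PD = {A :: complex^'m^'m. hermitian A} \<inter> (\<Union>A\<in>PD. ball A (r A))"
  proof (intro equalityI subsetI)
    fix A :: "complex^'m^'m" assume "A \<in> PD"
    then have "hermitian A" "r A > 0" using r(1) posdef_hermitian by (simp_all add: PD_def)
    with \<open>A \<in> PD\<close> show "A \<in> {A. hermitian A} \<inter> (\<Union>A\<in>PD. ball A (r A))"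
      by (intro IntI CollectI UN_I[of A]) simp_all
  next
    fix B :: "complex^'m^'m" assume "B \<in> {A. hermitian A} \<inter> (\<Union>A\<in>PD. ball A (r A))"
    then obtain A where "A \<in> PD" "hermitian B" "norm (B - A) < r A"
      by (auto simp: dist_norm norm_minus_commute)
    then have "posdef B" by (rule r(2))
    then show "B \<in> PD" by (simp add: PD_def)
  qed
  moreover have "open (\<Union>A\<in>PD. ball A (r A))" by auto
  ultimately show ?thesis
    using closed_hermitian by (metis borel_closed borel_open sets.Int)
qed

lemma mfun_measurable:
  assumes "continuous_on PD (mfun f :: complex^'m^'m \<Rightarrow> complex^'m^'m)"
  shows "(mfun f :: complex^'m^'m \<Rightarrow> complex^'m^'m) \<in> borel_measurable borel"
proof -
  \<comment> \<open>The default value 0 of \<open>mfun\<close> makes it continuous on a Borel set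
    and constant on the complement.\<close>
  have "(\<lambda>A. if A \<in> PD then mfun f A else 0) \<in> borel_measurable (borel :: (complex^'m^'m) measure)"
    by (rule borel_measurable_continuous_on_if[OF PD_borel assms]) auto
  moreover have "(\<lambda>A. if A \<in> PD then mfun f A else 0) = (mfun f :: complex^'m^'m \<Rightarrow> complex^'m^'m)"
    by (auto simp: fun_eq_iff mfun_def PD_def)
  ultimately show ?thesis by simp
qed

lemma mlog_measurable [measurable]: "mlog \<in> borel_measurable borel"
  using mfun_measurable[of ln] mlog_continuous_on unfolding mlog_def by simp

lemma mpow_measurable [measurable]: "(\<lambda>A. mpow A t) \<in> borel_measurable borel"
  using mfun_measurable[of "\<lambda>x. x powr t"] mpow_continuous_on[of t] unfolding mpow_def by simp

lemma matrix_mult_measurable [measurable (raw)]: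
  fixes f g :: "'a \<Rightarrow> complex^'m^'m"
  assumes "f \<in> borel_measurable M" "g \<in> borel_measurable M"
  shows "(\<lambda>x. f x ** g x) \<in> borel_measurable M"
  by (rule borel_measurable_continuous_Pair[OF assms]) (intro continuous_intros)

text \<open>The first bound is ln(1 + x) = x + O(x^2) applied to each eigenvalue. All of them are
  within \<open>norm (P - mat 1)\<close> of 1, and the constant 2 is the scalar one for |x| at most
  1/2.\<close>

lemma mlog_near_1:
  assumes P: "posdef P" and near: "norm (P - mat 1) \<le> 1/2"
  shows "norm (mlog P - (P - mat 1)) \<le> 2 * (norm (P - mat 1))\<^sup>2"
    and "norm (mlog P) \<le> 2 * norm (P - mat 1)"
proof -
  obtain U d where U: "unitary U" "\<And>i. d i > 0" "P = udiag U d"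
    using P by (rule posdef_udiagE) auto
  define n where "n = norm (P - mat 1)"
  have P1: "P - mat 1 = udiag U (\<lambda>i. d i - 1)"
    by (simp add: udiag_diff udiag_1 U)
  have n2: "n\<^sup>2 = (\<Sum>i\<in>UNIV. (d i - 1)\<^sup>2)"
    unfolding n_def P1 by (rule norm_udiag[OF U(1)])
  have d_le: "\<bar>d i - 1\<bar> \<le> n" for i
  proof (rule power2_le_imp_le)
    show "\<bar>d i - 1\<bar>\<^sup>2 \<le> n\<^sup>2"
      unfolding n2 power2_abs by (rule member_le_sum) auto
  qed (simp add: n_def)
  have small: "n \<le> 1/2" using near by (simp add: n_def)
  have ln: "\<bar>ln (d i) - (d i - 1)\<bar> \<le> 2 * n * \<bar>d i - 1\<bar>" for i
  proof -
    have "\<bar>ln (1 + (d i - 1)) - (d i - 1)\<bar> \<le> 2 * (d i - 1)\<^sup>2"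
      using d_le[of i] small by (intro abs_ln_one_plus_x_minus_x_bound) linarith
    also have "\<dots> = 2 * \<bar>d i - 1\<bar> * \<bar>d i - 1\<bar>" by (simp add: power2_eq_square)
    also have "\<dots> \<le> 2 * n * \<bar>d i - 1\<bar>"
      using d_le[of i] by (intro mult_right_mono mult_left_mono) auto
    finally show ?thesis by simp
  qed
  have log: "mlog P = udiag U (\<lambda>i. ln (d i))"
    unfolding mlog_def U(3) by (rule mfun_udiag[OF U(1,2)])
  have "mlog P - (P - mat 1) = udiag U (\<lambda>i. ln (d i) - (d i - 1))"
    by (simp add: log P1 udiag_diff)
  then have "(norm (mlog P - (P - mat 1)))\<^sup>2 = (\<Sum>i\<in>UNIV. (ln (d i) - (d i - 1))\<^sup>2)"
    by (simp add: norm_udiag[OF U(1)])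
  also have "\<dots> \<le> (\<Sum>i\<in>UNIV. (2 * n)\<^sup>2 * (d i - 1)\<^sup>2)"
  proof (rule sum_mono)
    fix i show "(ln (d i) - (d i - 1))\<^sup>2 \<le> (2 * n)\<^sup>2 * (d i - 1)\<^sup>2"
      using power_mono[OF ln[of i] abs_ge_zero, of 2] by (simp add: power_mult_distrib)
  qed
  also have "\<dots> = (2 * n\<^sup>2)\<^sup>2"
    unfolding sum_distrib_left[symmetric] n2[symmetric] by (simp add: power2_eq_square)
  finally show *: "norm (mlog P - (P - mat 1)) \<le> 2 * (norm (P - mat 1))\<^sup>2"
    unfolding n_def[symmetric] by (rule power2_le_imp_le) simp
  have "2 * n\<^sup>2 \<le> n" using mult_left_mono[of "2 * n" 1 n] small by (simp add: power2_eq_square n_def)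
  with * show "norm (mlog P) \<le> 2 * norm (P - mat 1)"
    using norm_triangle_ineq[of "mlog P - (P - mat 1)" "P - mat 1"]
    unfolding diff_add_cancel n_def[symmetric] by linarith
qed

subsection \<open>The Riemannian distance\<close>

text \<open>The congruence that carries \<open>X\<close> to the identity. It is an isometry
  (\<open>rdist_sandw\<close>), so statements at the base point \<open>X\<close> reduce to
  statements at the identity.\<close>

definition sandw :: "complex^'m^'m \<Rightarrow> complex^'m^'m \<Rightarrow> complex^'m^'m" where
  "sandw X A = mpow X (-1/2) ** A ** mpow X (-1/2)"

text \<open>The initial velocity of the geodesic from \<open>X\<close> to \<open>A\<close>, transported to the identity.\<close>

definition logat :: "complex^'m^'m \<Rightarrow> complex^'m^'m \<Rightarrow> complex^'m^'m" where
  "logat X A = mlog (sandw X A)"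

lemma mpow_add_assoc: "posdef A \<Longrightarrow> mpow A s ** (mpow A t ** B) = mpow A (s + t) ** B"
  by (simp add: matrix_mul_assoc mpow_add)

lemmas mpow_simps = matrix_mul_assoc[symmetric] mpow_add mpow_add_assoc

lemma posdef_sandw: "posdef X \<Longrightarrow> posdef A \<Longrightarrow> posdef (sandw X A)"
  unfolding sandw_def by (intro posdef_congr posdef_mpow)

lemma sandw_self: "posdef X \<Longrightarrow> sandw X X = mat 1"
proof -
  assume X: "posdef X"
  have "sandw X X = mpow X (-1/2) ** mpow X 1 ** mpow X (-1/2)"
    using X by (simp add: sandw_def)
  then show ?thesis using X by (simp add: mpow_simps del: mpow_1)
qed

lemma sandw_mat_1 [simp]: "sandw (mat 1) A = A"
  by (simp add: sandw_def)

lemma sandw_inverse: "posdef X \<Longrightarrow> mpow X (1/2) ** sandw X A ** mpow X (1/2) = A"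
  by (simp add: sandw_def mpow_simps)

lemma sandw_mpow_congr: "posdef X \<Longrightarrow> sandw X (mpow X (1/2) ** A ** mpow X (1/2)) = A"
  by (simp add: sandw_def mpow_simps)

lemma wgeo_eq: "wgeo X t A = mpow X (1/2) ** mpow (sandw X A) t ** mpow X (1/2)"
  by (simp add: wgeo_def sandw_def)

lemma sandw_wgeo: "posdef X \<Longrightarrow> sandw X (wgeo X t A) = mpow (sandw X A) t"
  by (simp add: wgeo_eq sandw_mpow_congr)

lemma posdef_wgeo: "posdef X \<Longrightarrow> posdef A \<Longrightarrow> posdef (wgeo X t A)"
  unfolding wgeo_eq by (intro posdef_congr posdef_mpow posdef_sandw)

lemma logat_wgeo: "posdef X \<Longrightarrow> posdef A \<Longrightarrow> logat X (wgeo X t A) = t *\<^sub>R logat X A"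
  by (simp add: logat_def sandw_wgeo mlog_mpow posdef_sandw)

lemma cadj_logat: "posdef X \<Longrightarrow> posdef A \<Longrightarrow> cadj (logat X A) = logat X A"
  by (simp add: logat_def cadj_mlog posdef_sandw)

lemma rdist_eq_norm_logat: "posdef X \<Longrightarrow> posdef A \<Longrightarrow> rdist X A = norm (logat X A)"
  using norm_matrix_eq_trace[of "logat X A"] cadj_logat[of X A]
  by (simp add: rdist_def Let_def logat_def sandw_def real_sqrt_unique)

lemma mpow_minus_1_unique: "posdef A \<Longrightarrow> B ** A = mat 1 \<Longrightarrow> mpow A (-1) = B"
proof -
  assume A: "posdef A" and B: "B ** A = mat 1"
  have "A ** mpow A (-1) = mpow A 1 ** mpow A (-1)" using A by simp
  also have "\<dots> = mat 1" using A by (rule mpow_cancel) simp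
  finally have "B ** (A ** mpow A (-1)) = B" by simp
  then show ?thesis by (simp add: matrix_mul_assoc B)
qed

lemma mpow_minus_1_congr:
  assumes C: "posdef C" and A: "posdef A"
  shows "C ** mpow (C ** A ** C) (-1) ** C = mpow A (-1)"
proof -
  define A' where "A' = C ** A ** C"
  have A': "posdef A'" unfolding A'_def using A C by (rule posdef_congr)
  have inv: "mpow A' (-1) ** A' = mat 1"
    using mpow_cancel[OF A', of "-1" 1] A' by simp
  have CC: "C ** mpow C (-1) = mat 1"
    using mpow_cancel[OF C, of 1 "-1"] C by simp
  have "C ** mpow A' (-1) ** C ** A = C ** mpow A' (-1) ** C ** A ** (C ** mpow C (-1))"
    by (simp add: CC)
  also have "\<dots> = C ** (mpow A' (-1) ** A') ** mpow C (-1)"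
    by (simp add: A'_def matrix_mul_assoc)
  also have "\<dots> = mat 1" by (simp add: inv CC)
  finally show ?thesis
    using mpow_minus_1_unique[OF A] unfolding A'_def by metis
qed

text \<open>The matrix \<open>C ** mpow A (1/2)\<close> and the square root of
  \<open>C ** A ** C\<close> differ by a unitary factor. That factor intertwines the two matrices
  whose logarithms give the distances, and the Frobenius norm does not see it.\<close>

lemma rdist_congr:
  assumes A: "posdef A" and B: "posdef B" and C: "posdef C"
  shows "rdist (C ** A ** C) (C ** B ** C) = rdist A B"
proof -
  define A' B' where "A' = C ** A ** C" and "B' = C ** B ** C"
  have A': "posdef A'" and B': "posdef B'" unfolding A'_def B'_def using A B C by (simp_all add: posdef_congr)
  \<comment> \<open>The unitary factor in the polar decomposition of
    \<open>C ** mpow A (1/2)\<close>.\<close>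
  define T where "T = mpow A' (-1/2) ** C ** mpow A (1/2)"
  have key: "C ** (mpow A' (-1) ** (C ** X)) = mpow A (-1) ** X" for X
    using mpow_minus_1_congr[OF C A] unfolding A'_def by (metis matrix_mul_assoc)
  have "cadj C = C" using C by (simp add: posdef_def hermitian_def)
  then have "cadj T ** T = mat 1"
    using A A' by (simp add: T_def cadj_mult cadj_mpow mpow_simps key)
  then have T: "unitary T" by (simp add: unitary_def)
  have "sandw A' B' ** T = T ** sandw A B"
    using A A' by (simp add: T_def sandw_def B'_def mpow_simps key)
  then have "logat A' B' ** T = T ** logat A B"
    unfolding logat_def mlog_def by (intro mfun_intertwine posdef_sandw A B A' B')
  then have "norm (logat A' B') = norm (logat A B)"
    by (metis T norm_mult_unitary norm_unitary_mult)
  then show ?thesis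
    using A B A' B' by (simp add: rdist_eq_norm_logat A'_def B'_def)
qed

lemma rdist_sandw: "posdef X \<Longrightarrow> posdef A \<Longrightarrow> posdef B \<Longrightarrow> rdist (sandw X A) (sandw X B) = rdist A B"
  unfolding sandw_def by (intro rdist_congr posdef_mpow)

text \<open>A congruence moves \<open>A\<close> to the identity and \<open>B\<close> to some
  \<open>R\<close>. The two distances then become the norms of log R and log R^-1 = - log R.\<close>

lemma rdist_commute:
  assumes A: "posdef A" and B: "posdef B"
  shows "rdist A B = rdist B A"
proof -
  define R where "R = sandw A B"
  have R: "posdef R" unfolding R_def using A B by (rule posdef_sandw)
  have "sandw R (mat 1) = mpow R (-1)"
    using R by (simp add: sandw_def mpow_add)
  then have "rdist R (mat 1) = norm (mlog R)"
    using R by (simp add: rdist_eq_norm_logat posdef_mat_1 logat_def mlog_mpow)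
  then have "rdist (mat 1) R = rdist R (mat 1)"
    using R by (simp add: rdist_eq_norm_logat posdef_mat_1 logat_def)
  then show ?thesis
    using rdist_sandw[OF A A B] rdist_sandw[OF A B A] by (simp add: R_def sandw_self A)
qed

section \<open>Comparison of logarithms with the Riemannian distance\<close>

text \<open>With y = sqrt x the right-hand side is (y - 1/y)^2 and ln x = 2 ln y. For y at least 1,
  the function y - 1/y - 2 ln y vanishes at 1 and has derivative (1 - 1/y)^2. The case x < 1 follows
  by passing to 1/x.\<close>

lemma ln_square_le:
  fixes x :: real
  assumes "x > 0"
  shows "(ln x)\<^sup>2 \<le> x + 1 / x - 2"
proof -
  have *: "2 * ln y \<le> y - 1 / y" if "y \<ge> 1" for y :: real
  proof -
    have "(\<lambda>y. y - 1 / y - 2 * ln y) 1 \<le> (\<lambda>y. y - 1 / y - 2 * ln y) y"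
    proof (rule DERIV_nonneg_imp_nondecreasing[OF that])
      fix t :: real assume t: "1 \<le> t" "t \<le> y"
      have "((\<lambda>y. y - 1 / y - 2 * ln y) has_real_derivative (1 - 1 / t)\<^sup>2) (at t)"
        using t by (auto intro!: derivative_eq_intros simp: field_simps power2_eq_square)
      then show "\<exists>D. ((\<lambda>y. y - 1 / y - 2 * ln y) has_real_derivative D) (at t) \<and> 0 \<le> D"
        using zero_le_power2 by blast
    qed
    then show ?thesis by simp
  qed
  have ge1: "(ln x)\<^sup>2 \<le> x + 1 / x - 2" if "x \<ge> 1" for x :: real
  proof -
    define y where "y = sqrt x"
    have y: "y \<ge> 1" "x = y\<^sup>2" using that by (simp_all add: y_def)
    have "ln x = 2 * ln y" using y by (simp add: ln_realpow)
    then have "(ln x)\<^sup>2 = (2 * ln y)\<^sup>2" by simp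
    also have "\<dots> \<le> (y - 1 / y)\<^sup>2" using y *[of y] by (intro power_mono) auto
    also have "\<dots> = x + 1 / x - 2" using y by (simp add: field_simps power2_eq_square)
    finally show ?thesis .
  qed
  show ?thesis
  proof (cases "x \<ge> 1")
    case False
    then have "(ln (1 / x))\<^sup>2 \<le> 1 / x + 1 / (1 / x) - 2"
      using assms by (intro ge1) (simp add: field_simps)
    then show ?thesis using assms by (simp add: ln_div algebra_simps)
  qed (rule ge1)
qed

lemma norm_mlog_diff_le_trace:
  fixes P Q :: "complex^'m^'m"
  assumes P: "posdef P" and Q: "posdef Q"
  shows "(norm (mlog P - mlog Q))\<^sup>2 \<le>
    Re (trace (mpow P (-1) ** Q)) + Re (trace (mpow Q (-1) ** P)) - 2 * real CARD('m)"
proof -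
  obtain U d where U: "unitary U" "\<And>i. d i > 0" "P = udiag U d"
    using P by (rule posdef_udiagE) auto
  obtain V e where V: "unitary V" "\<And>i. e i > 0" "Q = udiag V e"
    using Q by (rule posdef_udiagE) auto
  define w where "w i j = (cmod ((cadj U ** V) $ i $ j))\<^sup>2" for i j
  have W: "unitary (cadj U ** V)" using U V by (simp add: unitary_cadj unitary_mult)
  have P1: "mpow P (-1) = udiag U (\<lambda>i. 1 / d i)"
    using U less_imp_le[OF U(2)] by (simp add: mpow_def mfun_udiag powr_minus_divide)
  have Q1: "mpow Q (-1) = udiag V (\<lambda>i. 1 / e i)"
    using V less_imp_le[OF V(2)] by (simp add: mpow_def mfun_udiag powr_minus_divide)
  have tr1: "Re (trace (mpow P (-1) ** Q)) = (\<Sum>i\<in>UNIV. \<Sum>j\<in>UNIV. e j / d i * w i j)"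
    unfolding P1 V(3) trace_udiag_mult[OF U(1) V(1)] w_def by simp
  have "trace (mpow Q (-1) ** P) = trace (P ** mpow Q (-1))" by (rule trace_mul_sym)
  then have tr2: "Re (trace (mpow Q (-1) ** P)) = (\<Sum>i\<in>UNIV. \<Sum>j\<in>UNIV. d i / e j * w i j)"
    unfolding Q1 by (simp add: U(3) trace_udiag_mult[OF U(1) V(1)] w_def)
  \<comment> \<open>Each row of weights sums to 1, so the constant 2m can be spread over the double
    sum as the -2 in the scalar inequality.\<close>
  have m: "real CARD('m) = (\<Sum>i\<in>UNIV. \<Sum>j\<in>UNIV. w i j)"
    unfolding w_def sum_cmod_unitary_row[OF W] by simp
  have le: "(ln (d i) - ln (e j))\<^sup>2 \<le> e j / d i + d i / e j - 2" for i j
    using ln_square_le[of "d i / e j"] U(2)[of i] V(2)[of j] by (simp add: ln_div)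
  have "(norm (mlog P - mlog Q))\<^sup>2 = (\<Sum>i\<in>UNIV. \<Sum>j\<in>UNIV. (ln (d i) - ln (e j))\<^sup>2 * w i j)"
    using norm_udiag_diff[OF U(1) V(1), of "\<lambda>i. ln (d i)" "\<lambda>i. ln (e i)"] U V
    by (simp add: mlog_def mfun_udiag w_def)
  also have "\<dots> \<le> (\<Sum>i\<in>UNIV. \<Sum>j\<in>UNIV. (e j / d i + d i / e j - 2) * w i j)"
    by (intro sum_mono mult_right_mono le) (simp add: w_def)
  also have "\<dots> = Re (trace (mpow P (-1) ** Q)) + Re (trace (mpow Q (-1) ** P)) - 2 * real CARD('m)"
    unfolding tr1 tr2 m
    by (simp add: algebra_simps sum.distrib sum_subtractf sum_distrib_left)
  finally show ?thesis .
qed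

lemma norm_diff_chain:
  fixes g :: "nat \<Rightarrow> 'a :: real_normed_vector"
  assumes "\<And>k. norm (g k - g (Suc k)) \<le> c"
  shows "norm (g 0 - g n) \<le> of_nat n * c"
proof (induction n)
  case (Suc n)
  have "norm (g 0 - g (Suc n)) \<le> norm (g 0 - g n) + norm (g n - g (Suc n))"
    using norm_triangle_ineq[of "g 0 - g n" "g n - g (Suc n)"] by simp
  then show ?case using Suc assms[of n] by (simp add: algebra_simps)
qed simp

text \<open>Subdividing the geodesic from \<open>A\<close> to \<open>B\<close> into \<open>n\<close> equal pieces, the infinitesimal estimate
  above gives the bound in the limit.\<close>

theorem norm_mlog_diff_le_rdist:
  fixes A B :: "complex^'m^'m"
  assumes A: "posdef A" and B: "posdef B"
  shows "norm (mlog A - mlog B) \<le> rdist A B"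
proof -
  define P where "P = sandw A B"
  have P: "posdef P" unfolding P_def using A B by (rule posdef_sandw)
  obtain U r where U: "unitary U" "\<And>i. r i > 0" "P = udiag U r"
    using P by (rule posdef_udiagE) auto
  have g0: "wgeo A 0 B = A" and g1: "wgeo A 1 B = B"
    using A P sandw_inverse[OF A, of B] by (simp_all add: wgeo_eq P_def mpow_add)
  have inv: "mpow (wgeo A s B) (-1) = mpow A (-1/2) ** mpow P (-s) ** mpow A (-1/2)" for s
    by (rule mpow_minus_1_unique[OF posdef_wgeo[OF A B]])
      (use A P in \<open>simp add: wgeo_eq P_def[symmetric] mpow_simps\<close>)
  \<comment> \<open>Cyclicity of the trace leaves only the parameter difference: every piece of a
    uniform subdivision of the geodesic has the same bound \<open>S (1 / n)\<close>.\<close>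
  have tr: "trace (mpow (wgeo A s B) (-1) ** wgeo A t B) = trace (mpow P (t - s))" for s t
  proof -
    have "trace (mpow (wgeo A s B) (-1) ** wgeo A t B) =
        trace (mpow A (-1/2) ** (mpow P (t - s) ** mpow A (1/2)))"
      unfolding inv using A P by (simp add: wgeo_eq P_def[symmetric] mpow_simps)
    also have "\<dots> = trace ((mpow P (t - s) ** mpow A (1/2)) ** mpow A (-1/2))"
      by (rule trace_mul_sym)
    also have "\<dots> = trace (mpow P (t - s))" using A by (simp add: mpow_simps)
    finally show ?thesis .
  qed
  have trP: "Re (trace (mpow P h)) = (\<Sum>i\<in>UNIV. r i powr h)" for h
    using U by (simp add: mpow_def mfun_udiag trace_udiag)
  define S where "S h = (\<Sum>i\<in>UNIV. r i powr h + r i powr (-h) - 2)" for h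
  have S: "(norm (mlog (wgeo A s B) - mlog (wgeo A t B)))\<^sup>2 \<le> S (t - s)" for s t
    using norm_mlog_diff_le_trace[of "wgeo A s B" "wgeo A t B"] A B
    by (simp add: posdef_wgeo tr trP S_def sum.distrib sum_subtractf)
  have le: "norm (mlog A - mlog B) \<le> sqrt (\<Sum>i\<in>UNIV. (real n)\<^sup>2 * (r i powr (1 / n) + r i powr (- (1 / n)) - 2))"
    if n: "n > 0" for n
  proof -
    define g where "g k = mlog (wgeo A (real k / real n) B)" for k
    have "norm (g k - g (Suc k)) \<le> sqrt (S (1 / n))" for k
    proof (rule real_le_rsqrt)
      have "real (Suc k) / real n - real k / real n = 1 / n"
        by (simp add: diff_divide_distrib[symmetric])
      then show "(norm (g k - g (Suc k)))\<^sup>2 \<le> S (1 / n)"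
        using S[of "real k / real n" "real (Suc k) / real n"] by (simp add: g_def)
    qed
    from norm_diff_chain[of g, OF this] have "norm (g 0 - g n) \<le> real n * sqrt (S (1 / n))" .
    moreover have "g 0 = mlog A" "g n = mlog B" using n by (simp_all add: g_def g0 g1)
    moreover have "real n * sqrt (S (1 / n)) = sqrt ((real n)\<^sup>2 * S (1 / n))"
      by (simp add: real_sqrt_mult)
    ultimately show ?thesis by (simp add: S_def sum_distrib_left)
  qed
  \<comment> \<open>The factor n^2 is the number of pieces taken under the square root. With u = ln
    x the term is n^2 (2 sinh(u / (2n)))^2, whose limit is u^2.\<close>
  have lim: "(\<lambda>n. (real n)\<^sup>2 * (x powr (1 / n) + x powr (- (1 / n)) - 2)) \<longlonglongrightarrow> (ln x)\<^sup>2"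
    if "x > 0" for x :: real
    using that unfolding power2_eq_square by real_asymp
  have "(\<lambda>n. sqrt (\<Sum>i\<in>UNIV. (real n)\<^sup>2 * (r i powr (1 / n) + r i powr (- (1 / n)) - 2)))
      \<longlonglongrightarrow> sqrt (\<Sum>i\<in>UNIV. (ln (r i))\<^sup>2)"
    by (intro tendsto_intros lim U)
  moreover have "eventually (\<lambda>n. norm (mlog A - mlog B) \<le>
      sqrt (\<Sum>i\<in>UNIV. (real n)\<^sup>2 * (r i powr (1 / n) + r i powr (- (1 / n)) - 2))) sequentially"
    using eventually_gt_at_top[of 0] by eventually_elim (rule le)
  ultimately have "norm (mlog A - mlog B) \<le> sqrt (\<Sum>i\<in>UNIV. (ln (r i))\<^sup>2)"
    by (rule tendsto_lowerbound) simp
  also have "\<dots> = rdist A B"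
  proof -
    have "mlog P = udiag U (\<lambda>i. ln (r i))" using U by (simp add: mlog_def mfun_udiag)
    then show ?thesis
      using norm_udiag[OF U(1), of "\<lambda>i. ln (r i)"]
      by (simp add: rdist_eq_norm_logat[OF A B] logat_def P_def[symmetric] real_sqrt_unique)
  qed
  finally show ?thesis .
qed

section \<open>The law of cosines and the triangle inequality\<close>

text \<open>After transporting \<open>X\<close> to the identity, endpoints of geodesics are at least
  as far apart as their initial velocities. Squaring this inequality and expanding the norm gives
  the claim.\<close>

theorem rdist_law_of_cosines:
  assumes X: "posdef X" and A: "posdef A" and B: "posdef B"
  shows "(rdist A B)\<^sup>2 \<ge> (rdist X A)\<^sup>2 + (rdist X B)\<^sup>2 - 2 * inner (logat X A) (logat X B)"
proof -
  have "norm (logat X A - logat X B) \<le> rdist A B"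
    using norm_mlog_diff_le_rdist[of "sandw X A" "sandw X B"] rdist_sandw[OF X A B] assms
    by (simp add: posdef_sandw logat_def)
  then have "(norm (logat X A - logat X B))\<^sup>2 \<le> (rdist A B)\<^sup>2"
    by (intro power_mono) auto
  then show ?thesis
    using assms by (simp add: rdist_eq_norm_logat power2_norm_eq_inner inner_diff_left inner_diff_right
        inner_commute)
qed

lemma rdist_nonneg: "posdef A \<Longrightarrow> posdef B \<Longrightarrow> rdist A B \<ge> 0"
  by (simp add: rdist_eq_norm_logat)

lemma logat_self: "posdef X \<Longrightarrow> logat X X = 0"
  by (simp add: logat_def sandw_self)

text \<open>The law of cosines at a point dividing the geodesic from \<open>mat 1\<close> to \<open>R\<close> in the ratio
  \<open>s : 1 - s\<close>.\<close>

lemma norm_mlog_weighted_le: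
  assumes R: "posdef R" and C: "posdef C" and s: "0 \<le> s" "s \<le> 1"
  shows "s * (1 - s) * (norm (mlog R))\<^sup>2 \<le> (1 - s) * (rdist (mat 1) C)\<^sup>2 + s * (rdist C R)\<^sup>2"
proof -
  define X where "X = mpow R s"
  have X: "posdef X" unfolding X_def using R by (rule posdef_mpow)
  define u w where "u = mlog R" and "w = logat X C"
  have sandw: "sandw X (mpow R t) = mpow R (t - s)" for t
    using R by (simp add: sandw_def X_def mpow_mpow mpow_add)
  have l1: "logat X (mat 1) = - (s *\<^sub>R u)"
    using sandw[of 0] R by (simp add: logat_def mlog_mpow u_def)
  have lR: "logat X R = (1 - s) *\<^sub>R u"
    using sandw[of 1] R by (simp add: logat_def mlog_mpow u_def)
  have r1: "(rdist X (mat 1))\<^sup>2 = s\<^sup>2 * (norm u)\<^sup>2"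
    using X by (simp add: rdist_eq_norm_logat posdef_mat_1 l1 power_mult_distrib)
  have rR: "(rdist X R)\<^sup>2 = (1 - s)\<^sup>2 * (norm u)\<^sup>2"
    using X R by (simp add: rdist_eq_norm_logat lR power_mult_distrib)
  have "(rdist (mat 1) C)\<^sup>2 \<ge> s\<^sup>2 * (norm u)\<^sup>2 + (rdist X C)\<^sup>2 + 2 * s * inner u w"
    using rdist_law_of_cosines[OF X posdef_mat_1 C] by (simp add: r1 l1 w_def)
  then have "(1 - s) * (s\<^sup>2 * (norm u)\<^sup>2 + (rdist X C)\<^sup>2 + 2 * s * inner u w) \<le> (1 - s) * (rdist (mat 1) C)\<^sup>2"
    using s by (intro mult_left_mono) auto
  moreover have "(rdist C R)\<^sup>2 \<ge> (1 - s)\<^sup>2 * (norm u)\<^sup>2 + (rdist X C)\<^sup>2 - 2 * ((1 - s) * inner u w)"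
    using rdist_law_of_cosines[OF X C R] by (simp add: rR lR w_def inner_commute mult.assoc)
  then have "s * ((1 - s)\<^sup>2 * (norm u)\<^sup>2 + (rdist X C)\<^sup>2 - 2 * ((1 - s) * inner u w)) \<le> s * (rdist C R)\<^sup>2"
    using s by (intro mult_left_mono) auto
  \<comment> \<open>With weights 1 - s and s the inner product terms cancel, since the velocities
    from the dividing point towards the two ends are opposite multiples of \<open>u\<close>.\<close>
  moreover have "(1 - s) * (s\<^sup>2 * (norm u)\<^sup>2 + (rdist X C)\<^sup>2 + 2 * s * inner u w)
      + s * ((1 - s)\<^sup>2 * (norm u)\<^sup>2 + (rdist X C)\<^sup>2 - 2 * ((1 - s) * inner u w))
      = s * (1 - s) * (norm u)\<^sup>2 + (rdist X C)\<^sup>2"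
    by (simp add: power2_eq_square algebra_simps)
  ultimately show ?thesis unfolding u_def using zero_le_power2[of "rdist X C"] by linarith
qed

lemma rdist_triangle_mat_1:
  assumes R: "posdef R" and C: "posdef C"
  shows "norm (mlog R) \<le> rdist (mat 1) C + rdist C R"
proof (rule field_le_epsilon)
  fix e :: real assume e: "e > 0"
  \<comment> \<open>The summand e / 2 keeps both lengths positive, so that the ratio
    \<open>s\<close> lies strictly between 0 and 1.\<close>
  define p q where "p = rdist (mat 1) C + e / 2" and "q = rdist C R + e / 2"
  have pq: "p > 0" "q > 0" using e rdist_nonneg[OF posdef_mat_1 C] rdist_nonneg[OF C R]
    by (simp_all add: p_def q_def)
  \<comment> \<open>Division in the ratio p : q makes (1 - s) p^2 + s q^2 equal to pq, which is also
    s (1 - s) (p + q)^2.\<close>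
  define s where "s = p / (p + q)"
  have s: "0 < s" "s < 1" "1 - s = q / (p + q)" using pq by (simp_all add: s_def field_simps)
  have le: "(rdist (mat 1) C)\<^sup>2 \<le> p\<^sup>2" "(rdist C R)\<^sup>2 \<le> q\<^sup>2"
    using e R C posdef_mat_1 by (auto simp: p_def q_def intro!: power_mono rdist_nonneg)
  have "s * (1 - s) * (norm (mlog R))\<^sup>2 \<le> (1 - s) * (rdist (mat 1) C)\<^sup>2 + s * (rdist C R)\<^sup>2"
    using norm_mlog_weighted_le[OF R C, of s] s by simp
  also have "\<dots> \<le> (1 - s) * p\<^sup>2 + s * q\<^sup>2"
    using s le by (intro add_mono mult_left_mono) auto
  also have "\<dots> = s * (1 - s) * (p + q)\<^sup>2"
    unfolding s(3) unfolding s_def using pq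
    by (simp add: field_simps power2_eq_square)
  finally have "s * (1 - s) * (norm (mlog R))\<^sup>2 \<le> s * (1 - s) * (p + q)\<^sup>2" .
  moreover have "0 < s * (1 - s)" using s(1,2) by simp
  ultimately have "(norm (mlog R))\<^sup>2 \<le> (p + q)\<^sup>2" by (rule mult_left_le_imp_le)
  then have "norm (mlog R) \<le> p + q" by (rule power2_le_imp_le) (use pq in simp)
  then show "norm (mlog R) \<le> rdist (mat 1) C + rdist C R + e" by (simp add: p_def q_def)
qed

theorem rdist_triangle:
  assumes A: "posdef A" and B: "posdef B" and C: "posdef C"
  shows "rdist A B \<le> rdist A C + rdist C B"
  using rdist_triangle_mat_1[OF posdef_sandw[OF A B] posdef_sandw[OF A C]]
    rdist_sandw[OF A A C] rdist_sandw[OF A C B] assms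
  by (simp add: sandw_self rdist_eq_norm_logat logat_def)

section \<open>Topology and measurability of logarithms and distances\<close>

lemma logat_continuous_on:
  assumes X: "posdef X"
  shows "continuous_on PD (logat X)"
proof -
  have "continuous_on PD (\<lambda>A. mlog (sandw X A))"
    by (rule continuous_on_compose2[OF mlog_continuous_on])
      (use X posdef_sandw in \<open>auto simp: PD_def sandw_def[abs_def] intro!: continuous_intros\<close>)
  then show ?thesis by (simp add: logat_def[abs_def])
qed

lemma logat_measurable [measurable]: "logat X \<in> borel_measurable borel"
  unfolding logat_def[abs_def] sandw_def[abs_def] by measurable

lemma wgeo_measurable [measurable]: "wgeo X t \<in> borel_measurable borel"
  unfolding wgeo_def[abs_def] by measurable

lemma rdist_tendsto:
  assumes "X \<in> PD"
  shows "((\<lambda>A. rdist X A) \<longlongrightarrow> 0) (at X within PD)"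
proof -
  have X: "posdef X" using assms by (simp add: PD_def)
  have "((\<lambda>A. norm (logat X A)) \<longlongrightarrow> norm (logat X X)) (at X within PD)"
    using logat_continuous_on[OF X] assms by (intro tendsto_norm) (auto simp: continuous_on_def)
  then have "((\<lambda>A. norm (logat X A)) \<longlongrightarrow> 0) (at X within PD)" by (simp add: logat_self X)
  moreover have "eventually (\<lambda>A. norm (logat X A) = rdist X A) (at X within PD)"
    using X by (auto simp: eventually_at_filter PD_def rdist_eq_norm_logat)
  ultimately show ?thesis using Lim_transform_eventually by blast
qed

text \<open>On numbers at most \<open>r\<close> the exponential is Lipschitz with constant exp r,
  and the Frobenius norm of the logarithm bounds its eigenvalues. This yields injectivity of
  \<open>mlog\<close> and continuity of its inverse on balls.\<close>

lemma norm_diff_le_mlog: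
  fixes A B :: "complex^'m^'m"
  assumes A: "posdef A" and B: "posdef B" and r: "norm (mlog A) \<le> r" "norm (mlog B) \<le> r"
  shows "norm (A - B) \<le> exp r * norm (mlog A - mlog B)"
proof -
  have ln_le: "ln (d i) \<le> r" if U: "unitary U" "\<And>i. d i > 0" and n: "norm (mlog (udiag U d)) \<le> r"
    for U :: "complex^'m^'m" and d i
  proof -
    have "(ln (d i))\<^sup>2 \<le> (\<Sum>i\<in>UNIV. (ln (d i))\<^sup>2)" by (rule member_le_sum) auto
    also have "\<dots> = (norm (mlog (udiag U d)))\<^sup>2"
      using U by (simp add: mlog_def mfun_udiag norm_udiag)
    finally have "\<bar>ln (d i)\<bar> \<le> norm (mlog (udiag U d))"
      using abs_le_square_iff[of "ln (d i)" "norm (mlog (udiag U d))"] by simp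
    then show ?thesis using n by linarith
  qed
  obtain U d where U: "unitary U" "\<And>i. d i > 0" "A = udiag U d"
    using A by (rule posdef_udiagE) auto
  obtain V e where V: "unitary V" "\<And>i. e i > 0" "B = udiag V e"
    using B by (rule posdef_udiagE) auto
  have exp_le: "exp x - exp y \<le> exp r * (x - y)" if "y \<le> x" "x \<le> r" for x y :: real
  proof -
    have "exp x - exp y = exp x * (1 - exp (y - x))" by (simp add: algebra_simps exp_diff)
    also have "1 - exp (y - x) \<le> x - y" using exp_ge_add_one_self[of "y - x"] by linarith
    then have "exp x * (1 - exp (y - x)) \<le> exp x * (x - y)" by (intro mult_left_mono) auto
    also have "\<dots> \<le> exp r * (x - y)" using that by (intro mult_right_mono) auto
    finally show ?thesis .
  qed
  have exp_lip: "\<bar>exp x - exp y\<bar> \<le> exp r * \<bar>x - y\<bar>" if "x \<le> r" "y \<le> r" for x y :: real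
    using exp_le[of x y] exp_le[of y x] that by (cases "x \<le> y") (auto simp: abs_if)
  have "\<bar>d i - e j\<bar> \<le> exp r * \<bar>ln (d i) - ln (e j)\<bar>" for i j
    using exp_lip[of "ln (d i)" "ln (e j)"] ln_le[of U d i] ln_le[of V e j] r U V
    by simp
  then show ?thesis
    using norm_udiag_diff_mono[OF U(1) V(1), of "exp r" d e "\<lambda>i. ln (d i)" "\<lambda>i. ln (e i)"] U V
    by (simp add: mlog_def mfun_udiag)
qed

subsection \<open>The Cartan barycenter\<close>

lemma rdist_measurable [measurable]:
  "(\<lambda>A. rdist X A) \<in> borel_measurable borel" "(\<lambda>A. rdist A X) \<in> borel_measurable borel"
proof -
  \<comment> \<open>This form of the distance holds for arbitrary matrices, including those where
    \<open>mfun\<close> takes its default value, so measurability follows on the whole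
    space.\<close>
  have *: "rdist A B = sqrt (inner (logat A B) (cadj (logat A B)))" for A B :: "complex^'a^'a"
    by (simp add: rdist_def Let_def inner_matrix logat_def sandw_def)
  have [measurable]: "cadj \<in> borel_measurable borel"
    by (intro borel_measurable_continuous_onI linear_continuous_on bounded_linear_cadj)
  have [measurable]: "(\<lambda>A. logat A X) \<in> borel_measurable borel"
    unfolding logat_def sandw_def by measurable
  show "(\<lambda>A. rdist X A) \<in> borel_measurable borel" "(\<lambda>A. rdist A X) \<in> borel_measurable borel"
    unfolding * by measurable
qed

lemma udiag_tendsto:
  assumes "\<And>i. ((\<lambda>x. a x i) \<longlongrightarrow> b i) F"
  shows "((\<lambda>x. udiag U (a x)) \<longlongrightarrow> udiag U b) F"
proof -
  have "((\<lambda>x. if i = j then complex_of_real (a x i) else 0) \<longlongrightarrow> (if i = j then of_real (b i) else 0)) F"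
    for i j
    using tendsto_of_real[OF assms, of i, where 'a = complex] by (cases "i = j") auto
  then show ?thesis
    unfolding udiag_def diagm_def by (intro tendsto_intros tendsto_vec_lambda)
qed

lemma mpow_tendsto:
  assumes A: "posdef A" and f: "(f \<longlongrightarrow> t) F"
  shows "((\<lambda>x. mpow A (f x)) \<longlongrightarrow> mpow A t) F"
proof -
  obtain U d where U: "unitary U" "\<And>i. d i > 0" "A = udiag U d"
    using A by (rule posdef_udiagE) auto
  have "((\<lambda>x. udiag U (\<lambda>i. d i powr f x)) \<longlongrightarrow> udiag U (\<lambda>i. d i powr t)) F"
    using U(2) by (intro udiag_tendsto tendsto_powr tendsto_const f) (simp add: less_imp_neq[symmetric])
  then show ?thesis by (simp add: mpow_def mfun_udiag U)
qed

locale p1_measure = prob_space N for N :: "(complex^'m^'m) measure" +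
  assumes P1: "P1 N"
begin

lemma sets_eq_borel [measurable_cong]: "sets N = sets borel"
  using P1 by (simp add: P1_def)

lemma AE_posdef: "AE A in N. posdef A"
proof -
  have "prob PD = 1" using P1 by (simp add: P1_def measure_def)
  then show ?thesis using AE_prob_1[of PD] by (simp add: PD_def)
qed

text \<open>By the triangle inequality a finite first moment at one base point gives one at every
  base point.\<close>

lemma integrable_logat:
  assumes X: "posdef X"
  shows "integrable N (logat X)"
proof -
  obtain W where W: "posdef W" "(\<integral>\<^sup>+ Z. ennreal (rdist Z W) \<partial>N) < \<infinity>"
    using P1 by (auto simp: P1_def PD_def)
  have "(\<integral>\<^sup>+ Z. ennreal (norm (logat W Z)) \<partial>N) = (\<integral>\<^sup>+ Z. ennreal (rdist Z W) \<partial>N)"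
  proof (rule nn_integral_cong_AE)
    show "AE Z in N. ennreal (norm (logat W Z)) = ennreal (rdist Z W)"
      using AE_posdef
    proof eventually_elim
      case (elim Z)
      show ?case using rdist_commute[OF elim W(1)] rdist_eq_norm_logat[OF W(1) elim] by simp
    qed
  qed
  then have W_int: "integrable N (logat W)"
    using W(2) by (intro integrableI_bounded) (simp_all add: measurable_cong_sets[OF sets_eq_borel])
  show ?thesis
  proof (rule Bochner_Integration.integrable_bound)
    show "integrable N (\<lambda>A. rdist X W + norm (logat W A))" using W_int by simp
    show "AE A in N. norm (logat X A) \<le> norm (rdist X W + norm (logat W A))"
      using AE_posdef
    proof eventually_elim
      case (elim A)
      show ?case
        using rdist_triangle[OF X elim W(1)] rdist_nonneg[OF X W(1)] X W elim
        by (simp add: rdist_eq_norm_logat)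
    qed
  qed simp
qed

text \<open>A difference of squares factors as (a - b)(a + b): the first factor is bounded by d(Y,
  Z), the second grows linearly in the distance. Hence a first moment suffices.\<close>

lemma
  assumes Y: "posdef Y" and Z: "posdef Z"
  shows integrable_rdist_diff: "integrable N (\<lambda>A. (rdist Z A)\<^sup>2 - (rdist Y A)\<^sup>2)"
    and abs_cartan_obj_le: "\<bar>cartan_obj N Y Z\<bar> \<le> rdist Y Z * (rdist Y Z + 2 * (\<integral>A. norm (logat Y A) \<partial>N))"
proof -
  define b where "b A = rdist Y Z * (rdist Y Z + 2 * norm (logat Y A))" for A
  have b_int: "integrable N b" unfolding b_def using integrable_logat[OF Y] by simp
  have le: "AE A in N. norm ((rdist Z A)\<^sup>2 - (rdist Y A)\<^sup>2) \<le> b A"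
    using AE_posdef
  proof eventually_elim
    case (elim A)
    have n: "norm (logat Y A) = rdist Y A" by (simp add: rdist_eq_norm_logat elim Y)
    have "\<bar>rdist Z A - rdist Y A\<bar> \<le> rdist Y Z"
      using rdist_triangle[OF Z elim Y] rdist_triangle[OF Y elim Z] rdist_commute[OF Y Z] by linarith
    moreover have "rdist Z A + rdist Y A \<le> rdist Y Z + 2 * rdist Y A"
      using rdist_triangle[OF Z elim Y] rdist_commute[OF Y Z] by linarith
    ultimately have "\<bar>rdist Z A - rdist Y A\<bar> * (rdist Z A + rdist Y A) \<le> b A"
      unfolding b_def n
      using rdist_nonneg[OF Z elim] rdist_nonneg[OF Y elim] rdist_nonneg[OF Y Z]
      by (intro mult_mono) simp_all
    moreover have "\<bar>(rdist Z A)\<^sup>2 - (rdist Y A)\<^sup>2\<bar> = \<bar>rdist Z A - rdist Y A\<bar> * (rdist Z A + rdist Y A)"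
    proof -
      have "(rdist Z A)\<^sup>2 - (rdist Y A)\<^sup>2 = (rdist Z A - rdist Y A) * (rdist Z A + rdist Y A)"
        by (simp add: power2_eq_square algebra_simps)
      then show ?thesis
        using rdist_nonneg[OF Z elim] rdist_nonneg[OF Y elim] by (simp add: abs_mult)
    qed
    ultimately show ?case by simp
  qed
  then have le': "AE A in N. norm ((rdist Z A)\<^sup>2 - (rdist Y A)\<^sup>2) \<le> norm (b A)"
    by eventually_elim simp
  show int: "integrable N (\<lambda>A. (rdist Z A)\<^sup>2 - (rdist Y A)\<^sup>2)"
    by (rule Bochner_Integration.integrable_bound[OF b_int _ le']) measurable
  have "\<bar>cartan_obj N Y Z\<bar> \<le> (\<integral>A. norm ((rdist Z A)\<^sup>2 - (rdist Y A)\<^sup>2) \<partial>N)"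
    unfolding cartan_obj_def by (rule order_trans[OF _ integral_norm_bound]) simp
  also have "\<dots> \<le> (\<integral>A. b A \<partial>N)"
    using int b_int le by (intro integral_mono_AE) auto
  also have "\<dots> = rdist Y Z * (rdist Y Z + 2 * (\<integral>A. norm (logat Y A) \<partial>N))"
    using integrable_logat[OF Y] by (simp add: b_def prob_space)
  finally show "\<bar>cartan_obj N Y Z\<bar> \<le> rdist Y Z * (rdist Y Z + 2 * (\<integral>A. norm (logat Y A) \<partial>N))" .
qed

lemma cartan_obj_diff:
  assumes "posdef W" "posdef Y" "posdef Z"
  shows "cartan_obj N W Z - cartan_obj N W Y = cartan_obj N Y Z"
  unfolding cartan_obj_def using assms
  by (simp add: integrable_rdist_diff flip: Bochner_Integration.integral_diff)

text \<open>The integrated law of cosines: a gradient inequality for the objective at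
  \<open>X\<close> with a quadratic gain. It serves for sufficiency of the critical equation,
  uniqueness and coercivity.\<close>

lemma cartan_obj_ge:
  assumes X: "posdef X" and Z: "posdef Z"
  shows "cartan_obj N X Z \<ge> (rdist X Z)\<^sup>2 - 2 * inner (integral\<^sup>L N (logat X)) (logat X Z)"
proof -
  have "(\<integral>A. (rdist X Z)\<^sup>2 - 2 * inner (logat X A) (logat X Z) \<partial>N) \<le> cartan_obj N X Z"
    unfolding cartan_obj_def
  proof (rule integral_mono_AE)
    show "AE A in N. (rdist X Z)\<^sup>2 - 2 * inner (logat X A) (logat X Z) \<le> (rdist Z A)\<^sup>2 - (rdist X A)\<^sup>2"
      using AE_posdef
    proof eventually_elim
      case (elim A)
      show ?case
        using rdist_law_of_cosines[OF X Z elim] by (simp add: inner_commute)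
    qed
  qed (use integrable_logat[OF X] integrable_rdist_diff[OF X Z] in simp_all)
  then show ?thesis using integrable_logat[OF X] by (simp add: prob_space)
qed

text \<open>First variation along the geodesic \<open>t \<mapsto> Y\<^sup>t\<close>: the law of cosines at the point \<open>Y\<^sup>t\<close> bounds the
  difference quotient, so no differentiation under the integral is needed.\<close>

lemma inner_integral_logat_le_0:
  assumes X: "posdef X" and Y: "posdef Y" and min: "\<And>Z. posdef Z \<Longrightarrow> 0 \<le> cartan_obj N X Z"
  shows "inner (mlog Y) (integral\<^sup>L N (logat X)) \<le> 0"
proof -
  define s where "s n = 1 / (1 + real n)" for n
  have s0: "s n > 0" "s n \<le> 1" for n by (simp_all add: s_def)
  have slim: "s \<longlonglongrightarrow> 0" unfolding s_def[abs_def] by real_asymp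
  \<comment> \<open>The point \<open>X\<close> has been moved to the identity; \<open>L n A\<close>
    is the velocity towards the image of \<open>A\<close> as seen from the nearby point Y^(s
    n).\<close>
  define L where "L n A = logat (mpow Y (s n)) (sandw X A)" for n A
  have [measurable]: "L n \<in> borel_measurable borel" for n
    unfolding L_def[abs_def] logat_def sandw_def by measurable
  have Ys: "posdef (mpow Y r)" for r using Y by (rule posdef_mpow)
  have l1: "logat (mpow Y r) (mat 1) = - (r *\<^sub>R mlog Y)" for r
    using Y by (simp add: logat_def sandw_def mpow_mpow mpow_add mlog_mpow)
  have r1: "rdist (mpow Y r) (mat 1) = \<bar>r\<bar> * norm (mlog Y)" for r
    using Ys[of r] by (simp add: rdist_eq_norm_logat posdef_mat_1 l1)
  have rX: "rdist (mat 1) (sandw X A) = rdist X A" if "posdef A" for A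
    using rdist_sandw[OF X X that] by (simp add: sandw_self X)
  have bound: "AE A in N. norm (L n A) \<le> norm (mlog Y) + norm (logat X A)" for n
    using AE_posdef
  proof eventually_elim
    case (elim A)
    have "norm (L n A) = rdist (mpow Y (s n)) (sandw X A)"
      by (simp add: L_def rdist_eq_norm_logat Ys posdef_sandw X elim)
    also have "\<dots> \<le> rdist (mpow Y (s n)) (mat 1) + rdist (mat 1) (sandw X A)"
      by (intro rdist_triangle Ys posdef_sandw X elim posdef_mat_1)
    also have "\<dots> = s n * norm (mlog Y) + norm (logat X A)"
      using s0[of n] by (simp add: r1 rX[OF elim] rdist_eq_norm_logat X elim)
    also have "\<dots> \<le> norm (mlog Y) + norm (logat X A)"
      using s0[of n] mult_right_mono[of "s n" 1 "norm (mlog Y)"] by simp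
    finally show ?case .
  qed
  have lim: "AE A in N. (\<lambda>n. L n A) \<longlonglongrightarrow> logat X A"
    using AE_posdef
  proof eventually_elim
    case (elim A)
    have A': "posdef (sandw X A)" using X elim by (rule posdef_sandw)
    have "(\<lambda>n. mpow Y (s n * (-1/2)) ** sandw X A ** mpow Y (s n * (-1/2)))
        \<longlonglongrightarrow> mpow Y (0 * (-1/2)) ** sandw X A ** mpow Y (0 * (-1/2))"
      by (intro tendsto_intros mpow_tendsto[OF Y] slim)
    then have "(\<lambda>n. sandw (mpow Y (s n)) (sandw X A)) \<longlonglongrightarrow> sandw X A"
      using Y by (simp add: sandw_def[of "mpow Y _"] mpow_mpow)
    then show ?case
      unfolding L_def logat_def
      by (rule continuous_on_tendsto_compose[OF mlog_continuous_on])
        (use A' Ys in \<open>auto simp: PD_def posdef_sandw\<close>)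
  qed
  have w: "integrable N (\<lambda>A. norm (mlog Y) + norm (logat X A))"
    using integrable_logat[OF X] by simp
  have meas: "logat X \<in> borel_measurable N" "\<And>n. L n \<in> borel_measurable N"
    by measurable
  have "(\<lambda>n. integral\<^sup>L N (L n)) \<longlonglongrightarrow> integral\<^sup>L N (logat X)"
    by (rule integral_dominated_convergence[OF meas w lim bound])
  then have "(\<lambda>n. inner (mlog Y) (integral\<^sup>L N (L n))) \<longlonglongrightarrow> inner (mlog Y) (integral\<^sup>L N (logat X))"
    by (intro tendsto_intros)
  moreover have "inner (mlog Y) (integral\<^sup>L N (L n)) \<le> 0" for n
  proof -
    have L_int: "integrable N (L n)"
      by (rule integrable_dominated_convergence2[OF meas w lim bound])
    \<comment> \<open>The competitor in the original coordinates: the congruence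
      \<open>sandw X\<close> maps it to Y^(s n).\<close>
    define Z where "Z = mpow X (1/2) ** mpow Y (s n) ** mpow X (1/2)"
    have Z: "posdef Z" unfolding Z_def by (intro posdef_congr posdef_mpow X Y)
    have "0 \<le> cartan_obj N X Z" using Z by (rule min)
    also have "\<dots> \<le> (\<integral>A. - 2 * s n * inner (mlog Y) (L n A) \<partial>N)"
      unfolding cartan_obj_def
    proof (rule integral_mono_AE)
      show "AE A in N. (rdist Z A)\<^sup>2 - (rdist X A)\<^sup>2 \<le> - 2 * s n * inner (mlog Y) (L n A)"
        using AE_posdef
      proof eventually_elim
        case (elim A)
        have "rdist Z A = rdist (mpow Y (s n)) (sandw X A)"
          using rdist_sandw[OF X Z elim] by (simp add: Z_def sandw_mpow_congr X)
        then have "(rdist (mpow Y (s n)) (mat 1))\<^sup>2 + (rdist Z A)\<^sup>2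
            + 2 * s n * inner (mlog Y) (L n A) \<le> (rdist X A)\<^sup>2"
          using rdist_law_of_cosines[OF Ys posdef_mat_1 posdef_sandw[OF X elim], of "s n"]
          by (simp add: l1 L_def rX[OF elim] mult.assoc)
        then show ?case
          using zero_le_power2[of "rdist (mpow Y (s n)) (mat 1)"] by linarith
      qed
    qed (use L_int integrable_rdist_diff[OF X Z] in simp_all)
    \<comment> \<open>Minimality makes this quantity nonnegative, and its factor -2 s n is negative,
      so the inner product has the desired sign before the limit.\<close>
    also have "\<dots> = - 2 * s n * inner (mlog Y) (integral\<^sup>L N (L n))"
      using L_int by simp
    finally show ?thesis using s0(1)[of n] by (simp add: mult_le_0_iff)
  qed
  ultimately show ?thesis using LIMSEQ_le_const2 by blast
qed

text \<open>For necessity the variation is taken in the direction of the mean velocity itself, which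
  requires that mean to be the logarithm of a positive definite matrix, hence Hermitian. Sufficiency
  is \<open>cartan_obj_ge\<close> without its linear term.\<close>

lemma minimizer_iff:
  assumes X: "posdef X"
  shows "(\<forall>Z. posdef Z \<longrightarrow> 0 \<le> cartan_obj N X Z) \<longleftrightarrow> integral\<^sup>L N (logat X) = 0"
proof
  assume min: "\<forall>Z. posdef Z \<longrightarrow> 0 \<le> cartan_obj N X Z"
  let ?h = "integral\<^sup>L N (logat X)"
  have "cadj ?h = (\<integral>A. cadj (logat X A) \<partial>N)"
    by (rule integral_bounded_linear[OF bounded_linear_cadj integrable_logat[OF X], symmetric])
  also have "\<dots> = ?h"
  proof (rule integral_cong_AE)
    show "AE A in N. cadj (logat X A) = logat X A"
      using AE_posdef by eventually_elim (rule cadj_logat[OF X])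
    have "cadj \<in> borel_measurable borel"
      by (intro borel_measurable_continuous_onI linear_continuous_on bounded_linear_cadj)
    then show "(\<lambda>A. cadj (logat X A)) \<in> borel_measurable N"
      by measurable
  qed measurable
  finally have "hermitian ?h" by (simp add: hermitian_def)
  then obtain Y where "posdef Y" "mlog Y = ?h" by (rule hermitian_eq_mlog)
  then have "inner ?h ?h \<le> 0" using inner_integral_logat_le_0[OF X, of Y] min by simp
  then have "(norm ?h)\<^sup>2 \<le> 0" by (simp only: power2_norm_eq_inner)
  then show "?h = 0" by simp
next
  assume *: "integral\<^sup>L N (logat X) = 0"
  show "\<forall>Z. posdef Z \<longrightarrow> 0 \<le> cartan_obj N X Z"
  proof safe
    fix Z :: "complex^'m^'m" assume "posdef Z"
    from cartan_obj_ge[OF X this] have "(rdist X Z)\<^sup>2 \<le> cartan_obj N X Z" by (simp add: *)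
    then show "0 \<le> cartan_obj N X Z" by (rule order_trans[OF zero_le_power2])
  qed
qed

text \<open>Exchanging base point and argument changes the sign of the objective, so the quadratic
  gains at the two critical points add up to at most 0.\<close>

lemma critical_point_unique:
  assumes X: "posdef X" and Y: "posdef Y"
    and crit: "integral\<^sup>L N (logat X) = 0" "integral\<^sup>L N (logat Y) = 0"
  shows "X = Y"
proof -
  have "(rdist X Y)\<^sup>2 \<le> cartan_obj N X Y" "(rdist Y X)\<^sup>2 \<le> cartan_obj N Y X"
    using cartan_obj_ge[OF X Y] cartan_obj_ge[OF Y X] crit by simp_all
  moreover have "cartan_obj N X Y = - cartan_obj N Y X"
    using cartan_obj_diff[OF X Y X] by (simp add: cartan_obj_def)
  ultimately have "(rdist X Y)\<^sup>2 + (rdist Y X)\<^sup>2 \<le> 0" by linarith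
  then have "rdist X Y = 0" by (simp add: sum_power2_le_zero_iff)
  then have "mlog X = mlog Y" using norm_mlog_diff_le_rdist[OF X Y] by simp
  then show ?thesis
    using norm_diff_le_mlog[OF X Y, of "norm (mlog X)"] by simp
qed

lemma cartan_obj_tendsto:
  assumes W: "posdef W" and Z: "Z \<in> PD"
  shows "((\<lambda>Y. cartan_obj N W Y) \<longlongrightarrow> cartan_obj N W Z) (at Z within PD)"
proof -
  have Zp: "posdef Z" using Z by (simp add: PD_def)
  define c where "c = 2 * (\<integral>A. norm (logat Z A) \<partial>N)"
  have "((\<lambda>Y. rdist Z Y * (rdist Z Y + c)) \<longlongrightarrow> 0 * (0 + c)) (at Z within PD)"
    by (intro tendsto_intros rdist_tendsto Z)
  moreover have "eventually (\<lambda>Y. norm (cartan_obj N W Y - cartan_obj N W Z) \<le> rdist Z Y * (rdist Z Y + c))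
      (at Z within PD)"
    unfolding eventually_at_filter
  proof (rule always_eventually, safe)
    fix Y :: "complex^'m^'m" assume "Y \<in> PD"
    then have Y: "posdef Y" by (simp add: PD_def)
    show "norm (cartan_obj N W Y - cartan_obj N W Z) \<le> rdist Z Y * (rdist Z Y + c)"
      using abs_cartan_obj_le[OF Zp Y] by (simp add: cartan_obj_diff[OF W Zp Y] c_def)
  qed
  ultimately have "((\<lambda>Y. cartan_obj N W Y - cartan_obj N W Z) \<longlongrightarrow> 0) (at Z within PD)"
    unfolding mult_zero_left by (rule Lim_null_comparison[rotated])
  then show ?thesis by (simp add: LIM_zero_iff)
qed

text \<open>The objective is coercive by \<open>cartan_obj_ge\<close> at \<open>mat 1\<close>, so it suffices to minimise over the
  image under the matrix exponential \<open>E\<close> of a compact ball of Hermitian matrices.\<close>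

lemma critical_point_exists: "\<exists>X. posdef X \<and> integral\<^sup>L N (logat X) = 0"
proof -
  define E :: "complex^'m^'m \<Rightarrow> complex^'m^'m" where "E H = (SOME A. posdef A \<and> mlog A = H)" for H
  have E: "posdef (E H) \<and> mlog (E H) = H" if "hermitian H" for H
    unfolding E_def by (rule someI_ex) (metis hermitian_eq_mlog that)
  define h where "h = integral\<^sup>L N (logat (mat 1))"
  \<comment> \<open>By Cauchy-Schwarz the lower bound is at least |L| (|L| - 2 |h|) with L =
    \<open>mlog Y\<close>, so outside radius 2 |h| it is nonnegative, while the objective is 0 at
    the identity \<open>E 0\<close>.\<close>
  define r where "r = 2 * norm h"
  define K where "K = {H :: complex^'m^'m. hermitian H} \<inter> cball 0 r"
  have K_E: "posdef (E H)" "mlog (E H) = H" "norm H \<le> r" if "H \<in> K" for H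
    using that E by (auto simp: K_def)
  have "compact K"
    unfolding K_def by (intro closed_Int_compact closed_hermitian compact_cball)
  moreover have "0 \<in> K"
    by (simp add: K_def hermitian_def r_def vec_eq_iff)
  then have "K \<noteq> {}" by auto
  moreover have "continuous_on K (\<lambda>H. cartan_obj N (mat 1) (E H))"
  proof (rule continuous_on_compose2[where t = PD])
    show "continuous_on PD (cartan_obj N (mat 1))"
      by (simp add: continuous_on_def cartan_obj_tendsto posdef_mat_1)
    have "norm (E H - E H') \<le> exp r * norm (H - H')" if "H \<in> K" "H' \<in> K" for H H'
      using norm_diff_le_mlog[of "E H" "E H'" r] K_E that by simp
    then have "(exp r)-lipschitz_on K E" by (intro lipschitz_onI) (auto simp: dist_norm)
    then show "continuous_on K E" by (rule lipschitz_on_continuous_on)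
    show "E ` K \<subseteq> PD" using K_E by (auto simp: PD_def)
  qed
  ultimately obtain H where H: "H \<in> K"
    and Hmin: "\<And>H'. H' \<in> K \<Longrightarrow> cartan_obj N (mat 1) (E H) \<le> cartan_obj N (mat 1) (E H')"
    using continuous_attains_inf by (metis (no_types, lifting))
  \<comment> \<open>\<open>mlog\<close> is injective on positive definite matrices, so the choice in
    \<open>E\<close> really inverts it.\<close>
  have E_mlog: "E (mlog Y) = Y" if Y: "posdef Y" for Y
  proof -
    have "hermitian (mlog Y)" using cadj_mlog[OF Y] by (simp add: hermitian_def)
    then have "posdef (E (mlog Y))" "mlog (E (mlog Y)) = mlog Y" using E by blast+
    then have "norm (E (mlog Y) - Y) \<le> 0"
      using norm_diff_le_mlog[OF _ Y, of "E (mlog Y)" "norm (mlog Y)"] by simp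
    then show ?thesis by simp
  qed
  have min: "cartan_obj N (mat 1) (E H) \<le> cartan_obj N (mat 1) Y" if Y: "posdef Y" for Y
  proof (cases "norm (mlog Y) \<le> r")
    case True
    then have "mlog Y \<in> K" using cadj_mlog[OF Y] by (simp add: K_def hermitian_def)
    then show ?thesis using Hmin E_mlog[OF Y] by metis
  next
    case False
    have "cartan_obj N (mat 1) (E H) \<le> cartan_obj N (mat 1) (E 0)" by (rule Hmin) fact
    also have "\<dots> = 0" using E_mlog[OF posdef_mat_1] by (simp add: cartan_obj_def)
    also have "0 \<le> norm (mlog Y) * (norm (mlog Y) - r)"
      using False by (intro mult_nonneg_nonneg) auto
    also have "\<dots> \<le> (norm (mlog Y))\<^sup>2 - 2 * inner h (mlog Y)"
      using norm_cauchy_schwarz[of h "mlog Y"] by (simp add: r_def power2_eq_square algebra_simps)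
    also have "\<dots> \<le> cartan_obj N (mat 1) Y"
      using cartan_obj_ge[OF posdef_mat_1 Y]
      by (simp add: h_def rdist_eq_norm_logat posdef_mat_1 Y logat_def)
    finally show ?thesis .
  qed
  have EH: "posdef (E H)" using K_E H by simp
  have "0 \<le> cartan_obj N (E H) Z" if "posdef Z" for Z
    using min[OF that] cartan_obj_diff[OF posdef_mat_1 EH that] by linarith
  then show ?thesis using minimizer_iff[OF EH] EH by blast
qed

lemma barycenter_unique:
  assumes X: "posdef X" and crit: "integral\<^sup>L N (logat X) = 0"
  shows "barycenter N = X"
proof -
  \<comment> \<open>Changing the base point from \<open>mat 1\<close> to \<open>Z\<close> shifts the
    objective by a constant, which turns minimality at \<open>Z\<close> into nonnegativity.\<close>
  have "(\<forall>Y\<in>PD. cartan_obj N (mat 1) Z \<le> cartan_obj N (mat 1) Y) \<longleftrightarrow> integral\<^sup>L N (logat Z) = 0"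
    if Z: "posdef Z" for Z
    using minimizer_iff[OF Z] cartan_obj_diff[OF posdef_mat_1 Z] by (force simp: PD_def)
  then show ?thesis
    unfolding barycenter_def PD_def using X crit critical_point_unique
    by (intro the_equality) (auto simp: PD_def)
qed

lemma barycenter_critical:
  "posdef (barycenter N)" "integral\<^sup>L N (logat (barycenter N)) = 0"
  using critical_point_exists barycenter_unique by metis+

theorem barycenter_iff: "posdef X \<Longrightarrow> X = barycenter N \<longleftrightarrow> integral\<^sup>L N (logat X) = 0"
  using barycenter_unique barycenter_critical by metis

end

section \<open>Push-forwards that scale logarithms\<close>

text \<open>Covers both families of measures: geodesic contraction towards \<open>X\<close> with
  \<open>W = X\<close>, and powers after the congruence with \<open>W = mat 1\<close>. The scaling
  of logarithms controls the first moment and the critical vector alike.\<close>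

lemma (in p1_measure) P1_distr:
  assumes f [measurable]: "f \<in> borel_measurable borel" and f_pd: "\<And>A. posdef A \<Longrightarrow> posdef (f A)"
    and W: "posdef W" and X: "posdef X"
    and f_log: "\<And>A. posdef A \<Longrightarrow> logat W (f A) = t *\<^sub>R logat X A"
  shows "P1 (distr N borel f)" "integral\<^sup>L (distr N borel f) (logat W) = t *\<^sub>R integral\<^sup>L N (logat X)"
proof -
  have "prob_space (distr N borel f)" by (rule prob_space_distr) measurable
  moreover have "emeasure (distr N borel f) PD = 1"
  proof -
    have "AE A in N. A \<in> f -` PD \<inter> space N"
      using AE_posdef AE_space by eventually_elim (simp add: PD_def f_pd)
    then have "emeasure N (f -` PD \<inter> space N) = 1"
      by (intro emeasure_eq_1_AE) measurable
    then show ?thesis by (subst emeasure_distr) measurable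
  qed
  moreover have "(\<integral>\<^sup>+ Z. ennreal (rdist Z W) \<partial>distr N borel f) < \<infinity>"
  proof -
    have "(\<integral>\<^sup>+ Z. ennreal (rdist Z W) \<partial>distr N borel f) = (\<integral>\<^sup>+ Z. ennreal (rdist (f Z) W) \<partial>N)"
      by (rule nn_integral_distr) measurable
    also have "\<dots> = (\<integral>\<^sup>+ Z. ennreal (norm (t *\<^sub>R logat X Z)) \<partial>N)"
    proof (rule nn_integral_cong_AE)
      show "AE Z in N. ennreal (rdist (f Z) W) = ennreal (norm (t *\<^sub>R logat X Z))"
        using AE_posdef
      proof eventually_elim
        case (elim Z)
        show ?case
          using rdist_commute[OF f_pd[OF elim] W] rdist_eq_norm_logat[OF W f_pd[OF elim]] f_log[OF elim]
          by simp
      qed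
    qed
    also have "\<dots> < \<infinity>"
      using integrable_scaleR_right[OF integrable_logat[OF X], of t]
      unfolding integrable_iff_bounded by simp
    finally show ?thesis .
  qed
  ultimately show "P1 (distr N borel f)" using W by (auto simp: P1_def PD_def)
  have "integral\<^sup>L (distr N borel f) (logat W) = (\<integral>A. logat W (f A) \<partial>N)"
    by (rule integral_distr) measurable
  also have "\<dots> = (\<integral>A. t *\<^sub>R logat X A \<partial>N)"
  proof (rule integral_cong_AE)
    show "AE A in N. logat W (f A) = t *\<^sub>R logat X A"
      using AE_posdef by eventually_elim (rule f_log)
  qed measurable
  finally show "integral\<^sup>L (distr N borel f) (logat W) = t *\<^sub>R integral\<^sup>L N (logat X)"
    by simp
qed

lemma p1_measure_iff: "p1_measure N \<longleftrightarrow> P1 N"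
  by (auto simp: p1_measure_def p1_measure_axioms_def P1_def)

lemma pow_meas_congr_meas:
  assumes [measurable_cong]: "sets N = sets borel"
  shows "pow_meas t (congr_meas X N) = distr N borel (\<lambda>A. mpow (sandw X A) t)"
proof -
  have "sandw X \<in> measurable N borel"
    unfolding sandw_def[abs_def] by measurable
  from distr_distr[OF mpow_measurable this, of t] show ?thesis
    by (simp add: pow_meas_def congr_meas_def o_def sandw_def[abs_def])
qed

section \<open>The derivative criterion\<close>

text \<open>The derivative of R^t at t = 0, sampled along a sequence because dominated convergence
  is applied to sequences; the shift by 1 avoids division by zero.\<close>

lemma mpow_difference_quotient_tendsto:
  assumes R: "posdef R"
  shows "(\<lambda>n. (1 + real n) *\<^sub>R (mpow R (1 / (1 + real n)) - mat 1)) \<longlonglongrightarrow> mlog R"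
proof -
  obtain U d where U: "unitary U" "\<And>i. d i > 0" "R = udiag U d"
    using R by (rule posdef_udiagE) auto
  have lim: "(\<lambda>n. (1 + real n) * (x powr (1 / (1 + real n)) - 1)) \<longlonglongrightarrow> ln x" if "x > 0" for x :: real
    using that by real_asymp
  have "(\<lambda>n. udiag U (\<lambda>i. (1 + real n) * (d i powr (1 / (1 + real n)) - 1))) \<longlonglongrightarrow> udiag U (\<lambda>i. ln (d i))"
    by (intro udiag_tendsto lim U)
  then show ?thesis
    unfolding mlog_def mpow_def U(3)
    by (simp add: mfun_udiag[OF U(1,2)] udiag_scaleR udiag_diff udiag_1[OF U(1)])
qed

text \<open>Since \<open>r n\<close> tends to infinity, \<open>P n \<longlonglongrightarrow> mat 1\<close>, where \<open>mlog P\<close> and \<open>P - mat 1\<close> agree to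
  first order.\<close>

lemma mlog_difference_quotient_tendsto:
  fixes P :: "nat \<Rightarrow> complex^'m^'m"
  assumes P: "\<And>n. posdef (P n)" and r: "filterlim r at_top sequentially"
    and lim: "(\<lambda>n. r n *\<^sub>R (P n - mat 1)) \<longlonglongrightarrow> L"
  shows "(\<lambda>n. r n *\<^sub>R mlog (P n)) \<longlonglongrightarrow> L"
proof -
  have r_pos: "eventually (\<lambda>n. r n > 0) sequentially"
    using r by (simp add: filterlim_at_top_dense)
  have "(\<lambda>n. inverse (r n)) \<longlonglongrightarrow> 0"
    using r by (rule tendsto_inverse_0_at_top)
  then have "(\<lambda>n. inverse (r n) *\<^sub>R (r n *\<^sub>R (P n - mat 1))) \<longlonglongrightarrow> 0 *\<^sub>R L"
    by (intro tendsto_intros lim)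
  then have "(\<lambda>n. inverse (r n) *\<^sub>R (r n *\<^sub>R (P n - mat 1))) \<longlonglongrightarrow> 0" by simp
  then have P1: "(\<lambda>n. P n - mat 1) \<longlonglongrightarrow> 0"
    by (rule Lim_transform_eventually) (use r_pos in eventually_elim, simp)
  then have near: "eventually (\<lambda>n. norm (P n - mat 1) \<le> 1/2) sequentially"
    using tendstoD[OF P1, of "1/2"] by (auto elim!: eventually_mono)
  have "(\<lambda>n. 2 * norm (r n *\<^sub>R (P n - mat 1)) * norm (P n - mat 1)) \<longlonglongrightarrow> 2 * norm L * norm (0 :: complex^'m^'m)"
    by (intro tendsto_intros lim P1)
  then have "(\<lambda>n. 2 * norm (r n *\<^sub>R (P n - mat 1)) * norm (P n - mat 1)) \<longlonglongrightarrow> 0" by simp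
  moreover have "eventually (\<lambda>n. norm (r n *\<^sub>R mlog (P n) - r n *\<^sub>R (P n - mat 1)) \<le>
      2 * norm (r n *\<^sub>R (P n - mat 1)) * norm (P n - mat 1)) sequentially"
    using near
  proof eventually_elim
    case (elim n)
    have "\<bar>r n\<bar> * norm (mlog (P n) - (P n - mat 1)) \<le> \<bar>r n\<bar> * (2 * (norm (P n - mat 1))\<^sup>2)"
      by (intro mult_left_mono mlog_near_1(1)[OF P elim]) simp
    then show ?case
      by (simp add: power2_eq_square algebra_simps flip: scaleR_diff_right)
  qed
  ultimately have "(\<lambda>n. r n *\<^sub>R mlog (P n) - r n *\<^sub>R (P n - mat 1)) \<longlonglongrightarrow> 0"
    by (rule Lim_null_comparison[rotated])
  from tendsto_add[OF this lim] show ?thesis by simp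
qed

lemma (in p1_measure) critical_if_derivative_zero:
  assumes X: "posdef X"
    and der: "((\<lambda>t. barycenter (push_geo X t N)) has_vector_derivative 0) (at 0)"
  shows "integral\<^sup>L N (logat X) = 0"
proof -
  have push: "P1 (push_geo X t N)"
    "integral\<^sup>L (push_geo X t N) (logat X) = t *\<^sub>R integral\<^sup>L N (logat X)" for t
    unfolding push_geo_def
    using P1_distr[of "wgeo X t" X X t] posdef_wgeo[OF X] logat_wgeo[OF X] X by simp_all
  have push_p1: "p1_measure (push_geo X t N)" for t using push by (simp add: p1_measure_iff)
  define r where "r n = 1 + real n" for n
  have r_pos: "r n > 0" for n by (simp add: r_def)
  have r_lim: "filterlim r at_top sequentially"
    unfolding r_def[abs_def] by real_asymp
  define B where "B n = barycenter (push_geo X (1 / r n) N)" for n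
  have B: "posdef (B n)" for n
    unfolding B_def using push_p1 by (rule p1_measure.barycenter_critical)
  have crit: "integral\<^sup>L (push_geo X (1 / r n) N) (logat (B n)) = 0" for n
    unfolding B_def using push_p1 by (rule p1_measure.barycenter_critical)
  have "barycenter (push_geo X 0 N) = X"
    by (rule p1_measure.barycenter_unique[OF push_p1 X]) (simp add: push)
  then have "((\<lambda>h. norm (barycenter (push_geo X h N) - X) / norm h) \<longlongrightarrow> 0) (at 0)"
    using der unfolding has_vector_derivative_def has_derivative_at by simp
  moreover have "filterlim (\<lambda>n. 1 / r n) (at 0) sequentially"
    unfolding r_def by real_asymp
  ultimately have "(\<lambda>n. norm (B n - X) / norm (1 / r n)) \<longlonglongrightarrow> 0"
    unfolding B_def by (rule filterlim_compose)
  then have "(\<lambda>n. norm (r n *\<^sub>R (X - B n))) \<longlonglongrightarrow> 0"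
    by (simp add: norm_minus_commute mult.commute)
  \<comment> \<open>This is the whole content of the vanishing derivative: the barycenters approach
    \<open>X\<close> faster than the parameter 1 / r n tends to 0.\<close>
  then have BX: "(\<lambda>n. r n *\<^sub>R (X - B n)) \<longlonglongrightarrow> 0" by (rule tendsto_norm_zero_cancel)
  have r_inv: "(\<lambda>n. inverse (r n)) \<longlonglongrightarrow> 0"
    using r_lim by (rule tendsto_inverse_0_at_top)
  have "(\<lambda>n. X - inverse (r n) *\<^sub>R (r n *\<^sub>R (X - B n))) \<longlonglongrightarrow> X - 0 *\<^sub>R 0"
    by (intro tendsto_intros BX r_inv)
  then have B_lim: "B \<longlonglongrightarrow> X"
    using r_pos by (simp add: less_imp_neq[THEN not_sym])
  define D where "D n = mpow (B n) (-1/2)" for n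
  have D_lim: "D \<longlonglongrightarrow> mpow X (-1/2)"
    unfolding D_def using B X
    by (intro continuous_on_tendsto_compose[OF mpow_continuous_on B_lim]) (auto simp: PD_def)
  define F where "F n A = r n *\<^sub>R logat (B n) (wgeo X (1 / r n) A)" for n A
  have [measurable]: "F n \<in> borel_measurable borel" for n
    unfolding F_def[abs_def] by measurable

  have lim: "AE A in N. (\<lambda>n. F n A) \<longlonglongrightarrow> logat X A"
    using AE_posdef
  proof eventually_elim
    case (elim A)
    define R where "R = sandw X A"
    have R: "posdef R" unfolding R_def using X elim by (rule posdef_sandw)
    define P where "P n = sandw (B n) (wgeo X (1 / r n) A)" for n
    define X2 where "X2 = mpow X (1/2)"
    have X22: "X2 ** X2 = X" using X by (simp add: X2_def mpow_add)
    \<comment> \<open>Since D n (B n) D n = I, the difference from the identity splits into the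
      difference quotient of the powers of \<open>R\<close>, and the displacement of the base point.
      The factors around the former tend to mutually inverse matrices, and the latter vanishes in
      the limit by \<open>BX\<close>.\<close>
    have P_eq: "r n *\<^sub>R (P n - mat 1) =
        D n ** X2 ** (r n *\<^sub>R (mpow R (1 / r n) - mat 1)) ** X2 ** D n +
        D n ** (r n *\<^sub>R (X - B n)) ** D n" for n
    proof -
      have 1: "P n = D n ** X2 ** mpow R (1 / r n) ** X2 ** D n"
        by (simp add: P_def sandw_def wgeo_def D_def X2_def R_def matrix_mul_assoc)
      have 2: "D n ** B n ** D n = mat 1"
        using sandw_self[OF B] by (simp add: sandw_def D_def)
      have 3: "D n ** X2 ** X2 ** D n = D n ** X ** D n"
        using X22 by (simp add: matrix_mul_assoc[symmetric])
      show ?thesis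
        by (simp add: 1 2 3 matrix_mult_scaleR_left matrix_mult_scaleR_right matrix_mult_diff_left
            matrix_mult_diff_right scaleR_diff_right)
    qed
    have "(\<lambda>n. r n *\<^sub>R (mpow R (1 / r n) - mat 1)) \<longlonglongrightarrow> mlog R"
      unfolding r_def using R by (rule mpow_difference_quotient_tendsto)
    then have "(\<lambda>n. r n *\<^sub>R (P n - mat 1)) \<longlonglongrightarrow>
        mpow X (-1/2) ** X2 ** mlog R ** X2 ** mpow X (-1/2) + mpow X (-1/2) ** 0 ** mpow X (-1/2)"
      unfolding P_eq by (intro tendsto_intros D_lim BX)
    also have "mpow X (-1/2) ** X2 ** mlog R ** X2 ** mpow X (-1/2) + mpow X (-1/2) ** 0 ** mpow X (-1/2) = mlog R"
      using X by (simp add: X2_def mpow_simps)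
    finally have "(\<lambda>n. r n *\<^sub>R (P n - mat 1)) \<longlonglongrightarrow> mlog R" .
    then have "(\<lambda>n. r n *\<^sub>R mlog (P n)) \<longlonglongrightarrow> mlog R"
      by (intro mlog_difference_quotient_tendsto[OF _ r_lim])
        (simp_all add: P_def posdef_sandw B posdef_wgeo X elim)
    then show ?case by (simp add: F_def logat_def P_def R_def)
  qed

  \<comment> \<open>The scaled distances are norms of a convergent sequence, hence bounded;
    \<open>c\<close> is the constant part of the dominating function.\<close>
  obtain c where c: "r n * rdist (B n) X \<le> c" for n
  proof -
    have "(\<lambda>n. D n ** (r n *\<^sub>R (X - B n)) ** D n) \<longlonglongrightarrow> mpow X (-1/2) ** 0 ** mpow X (-1/2)"
      by (intro tendsto_intros D_lim BX)
    moreover have "D n ** (r n *\<^sub>R (X - B n)) ** D n = r n *\<^sub>R (sandw (B n) X - mat 1)" for n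
      using sandw_self[OF B, of n]
      by (simp add: D_def sandw_def matrix_mult_scaleR_left matrix_mult_scaleR_right
          matrix_mult_diff_left matrix_mult_diff_right)
    ultimately have "(\<lambda>n. r n *\<^sub>R (sandw (B n) X - mat 1)) \<longlonglongrightarrow> 0" by simp
    then have "(\<lambda>n. r n *\<^sub>R mlog (sandw (B n) X)) \<longlonglongrightarrow> 0"
      by (rule mlog_difference_quotient_tendsto[OF posdef_sandw[OF B X] r_lim])
    then have "Bseq (\<lambda>n. r n *\<^sub>R mlog (sandw (B n) X))"
      by (rule convergent_imp_Bseq[OF convergentI])
    then obtain c where "\<And>n. norm (r n *\<^sub>R mlog (sandw (B n) X)) \<le> c" by (auto simp: Bseq_def)
    moreover have "norm (r n *\<^sub>R mlog (sandw (B n) X)) = r n * rdist (B n) X" for n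
      using r_pos[of n] by (simp add: rdist_eq_norm_logat B X logat_def)
    ultimately show thesis using that by metis
  qed

  have bound: "AE A in N. norm (F n A) \<le> c + norm (logat X A)" for n
    using AE_posdef
  proof eventually_elim
    case (elim A)
    have G: "posdef (wgeo X (1 / r n) A)" using X elim by (rule posdef_wgeo)
    have "norm (F n A) = r n * rdist (B n) (wgeo X (1 / r n) A)"
      using r_pos[of n] by (simp add: F_def rdist_eq_norm_logat B G)
    also have "\<dots> \<le> r n * (rdist (B n) X + rdist X (wgeo X (1 / r n) A))"
      using r_pos[of n] by (intro mult_left_mono rdist_triangle B G X) simp
    also have "\<dots> = r n * rdist (B n) X + norm (logat X A)"
      using r_pos[of n] by (simp add: rdist_eq_norm_logat X G logat_wgeo elim algebra_simps)
    also have "\<dots> \<le> c + norm (logat X A)" using c[of n] by simp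
    finally show ?case .
  qed
  have "(\<lambda>n. integral\<^sup>L N (F n)) \<longlonglongrightarrow> integral\<^sup>L N (logat X)"
  proof (rule integral_dominated_convergence[OF _ _ _ lim bound])
    show "integrable N (\<lambda>A. c + norm (logat X A))" using integrable_logat[OF X] by simp
  qed measurable
  \<comment> \<open>\<open>B n\<close> is a critical point for the pushed measure, and
    \<open>F n\<close> is a multiple of the corresponding integrand, so the limit is that of a zero
    sequence.\<close>
  moreover have "integral\<^sup>L N (F n) = 0" for n
  proof -
    have "integral\<^sup>L (push_geo X (1 / r n) N) (logat (B n)) = (\<integral>A. logat (B n) (wgeo X (1 / r n) A) \<partial>N)"
      unfolding push_geo_def by (rule integral_distr) measurable
    then show ?thesis unfolding F_def[abs_def] using crit[of n] by simp
  qed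
  ultimately show ?thesis by (simp add: LIMSEQ_const_iff)
qed

theorem theorem3p4:
  fixes X :: "complex^'m^'m" and M :: "(complex^'m^'m) measure" and \<beta> :: "real \<Rightarrow> complex^'m^'m"
  assumes "X \<in> PD" and "P1 M"
    and "\<beta> = (\<lambda>t. barycenter (push_geo X t M))"
  shows "((\<beta> has_vector_derivative 0) (at 0) \<longleftrightarrow> X = barycenter M)
    \<and> (X = barycenter M \<longleftrightarrow> (\<forall>t. X = barycenter (push_geo X t M)))
    \<and> ((\<forall>t. X = barycenter (push_geo X t M)) \<longleftrightarrow> (\<exists>t. t \<noteq> 0 \<and> X = barycenter (push_geo X t M)))
    \<and> (X = barycenter M \<longleftrightarrow> (\<forall>t. mat 1 = barycenter (pow_meas t (congr_meas X M))))
    \<and> ((\<forall>t. mat 1 = barycenter (pow_meas t (congr_meas X M))) \<longleftrightarrow>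
         (\<exists>t. t \<noteq> 0 \<and> mat 1 = barycenter (pow_meas t (congr_meas X M))))"
proof -
  interpret p1_measure M using assms(2) by (simp add: p1_measure_iff)
  have X: "posdef X" using assms(1) by (simp add: PD_def)
  \<comment> \<open>Half the negative gradient of the objective at \<open>X\<close>, read at the
    identity. Every condition of the theorem becomes \<open>h = 0\<close> or
    \<open>t *\<^sub>R h = 0\<close>, and for nonzero \<open>t\<close> these coincide.\<close>
  define h where "h = integral\<^sup>L M (logat X)"
  have bary: "X = barycenter M \<longleftrightarrow> h = 0"
    unfolding h_def using X by (rule barycenter_iff)
  have push: "X = barycenter (push_geo X t M) \<longleftrightarrow> t *\<^sub>R h = 0" for t
  proof -
    have "P1 (push_geo X t M)" "integral\<^sup>L (push_geo X t M) (logat X) = t *\<^sub>R h"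
      unfolding push_geo_def h_def
      using P1_distr[of "wgeo X t" X X t] posdef_wgeo[OF X] logat_wgeo[OF X] X by simp_all
    then show ?thesis using p1_measure.barycenter_iff[OF _ X] by (simp add: p1_measure_iff)
  qed
  have pow: "mat 1 = barycenter (pow_meas t (congr_meas X M)) \<longleftrightarrow> t *\<^sub>R h = 0" for t
  proof -
    have [measurable]: "(\<lambda>A. mpow (sandw X A) t) \<in> borel_measurable borel"
      unfolding sandw_def by measurable
    have "logat (mat 1) (mpow (sandw X A) t) = t *\<^sub>R logat X A" if "posdef A" for A
      using X that by (simp add: logat_def mlog_mpow posdef_sandw)
    then have "P1 (pow_meas t (congr_meas X M))"
      "integral\<^sup>L (pow_meas t (congr_meas X M)) (logat (mat 1)) = t *\<^sub>R h"
      unfolding pow_meas_congr_meas[OF sets_eq_borel] h_def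
      using P1_distr[of "\<lambda>A. mpow (sandw X A) t" "mat 1" X t] X
      by (simp_all add: posdef_mpow posdef_sandw posdef_mat_1)
    then show ?thesis
      using p1_measure.barycenter_iff[of "pow_meas t (congr_meas X M)", OF _ posdef_mat_1]
      by (simp add: p1_measure_iff)
  qed
  have "(\<beta> has_vector_derivative 0) (at 0) \<longleftrightarrow> h = 0"
  proof
    assume "(\<beta> has_vector_derivative 0) (at 0)"
    then show "h = 0"
      unfolding h_def assms(3) by (rule critical_if_derivative_zero[OF X])
  next
    assume "h = 0"
    \<comment> \<open>All pushed measures then have \<open>X\<close> as critical point, so \<beta>
      is constant.\<close>
    then have "\<beta> = (\<lambda>t. X)" using push assms(3) by auto
    then show "(\<beta> has_vector_derivative 0) (at 0)" by simp
  qed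
  moreover have "(\<forall>t. t *\<^sub>R h = 0) \<longleftrightarrow> h = 0" "(\<exists>t. t \<noteq> 0 \<and> t *\<^sub>R h = 0) \<longleftrightarrow> h = 0"
    by (auto intro: exI[of _ 1] dest: spec[of _ 1])
  ultimately show ?thesis by (simp only: bary push pow simp_thms)
qed

end
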